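(* Let $p$ be an odd prime, let $s,h,t,r$ be positive integers with $r$ odd, $t\mid h$, $s\le h$, $\gcd(r,p)=1$, and let $q=p^h$. Assume that $\mathbb{F}_q$ is the splitting field of $g(x)=x^{rp^s}+ax^{rp^s-1}+bx^{rp^s-2}+c\in\mathbb{F}_{p^t}[x]$ with $a,b,c\ne0$, and that $\alpha_1,\dots,\alpha_{rp^s}$ are all the roots of $g(x)$ and are pairwise distinct. Let $v_i\in\mathbb{F}_{q^2}$ be such that $v_i^2=(g'(\alpha_i))^{-1}$ for $1\le i\le rp^s$ (such $v_i$ exist). Let $\boldsymbol{\alpha}=(\alpha_1,\dots,\alpha_{rp^s})$, $\boldsymbol{v}=(v_1,\dots,v_{rp^s})$, and $$\mathcal{S}_1=\Big\{\sum_{i=0}^{\frac{rp^s-1}{2}-1}f_ix^i+\frac2b\,f_{\frac{rp^s-1}{2}-1}\Big(a\,x^{\frac{rp^s-1}{2}}+x^{\frac{rp^s-1}{2}+1}\Big): f_i\in\mathbb{F}_{q^2}\text{ for }0\le i\le\tfrac{rp^s-1}{2}-1\Big\},$$ and let $\mathcal{C}_1=ev_{\boldsymbol{\alpha},\boldsymbol{v}}(\mathcal{S}_1)\subseteq\mathbb{F}_{q^2}^{rp^s}$. Then there exists a $[[rp^s,\,1,\,\mathrm{wt}(\mathcal{C}_1^\perp\setminus\mathcal{C}_1)]]_{q^2}$ quantum stabilizer code.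
   Context: $ev_{\boldsymbol{\alpha},\boldsymbol{v}}(f)=(v_1f(\alpha_1),\dots,v_nf(\alpha_n))$. $\mathcal{C}^\perp$ is the Euclidean dual. For a set $X$ of vectors, $\mathrm{wt}(X)$ is the minimum Hamming weight of a nonzero element of $X$. Quantum codes: let $Q$ be a power of a prime $p$ (here $Q=q^2$), $\zeta=e^{2\pi i/p}$, $\mathrm{Tr}:\mathbb{F}_Q\to\mathbb{F}_p$ the trace; on $\mathbb{C}^Q$ with orthonormal basis $\{|x\rangle:x\in\mathbb{F}_Q\}$ let $X(a)|x\rangle=|x+a\rangle$, $Z(b)|x\rangle=\zeta^{\mathrm{Tr}(bx)}|x\rangle$, and for $\boldsymbol{a},\boldsymbol{b}\in\mathbb{F}_Q^n$ let $X(\boldsymbol{a})=\bigotimes X(a_i)$, $Z(\boldsymbol{b})=\bigotimes Z(b_i)$ on $(\mathbb{C}^Q)^{\otimes n}$. The error group consists of all $\zeta^cX(\boldsymbol{a})Z(\boldsymbol{b})$; the weight of such an element is the number of $i$ with $(a_i,b_i)\neq(0,0)$. A stabilizer code is a nonzero joint $+1$-eigenspace of an abelian subgroup of the error group. It is an $[[n,K,d]]_Q$ code if it has dimension $Q^K$ and minimum distance $d$, i.e. $d$ is the largest integer such that every error $E$ of weight less than $d$ is detectable ($PEP=c_EP$ for a scalar $c_E$, $P$ the orthogonal projector onto the code). *)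

theory Defs
  imports
    "HOL-Analysis.Analysis"
    "HOL-Computational_Algebra.Computational_Algebra"
begin

definition is_subfield :: "'a::field set \<Rightarrow> bool" where
  "is_subfield K \<longleftrightarrow> 0 \<in> K \<and> 1 \<in> K \<and>
     (\<forall>x\<in>K. \<forall>y\<in>K. x - y \<in> K \<and> x * y \<in> K) \<and> (\<forall>x\<in>K. inverse x \<in> K)"

definition poly_over :: "'a::field set \<Rightarrow> 'a poly \<Rightarrow> bool" where
  "poly_over K f \<longleftrightarrow> (\<forall>i. coeff f i \<in> K)"

definition splits_over :: "'a::field set \<Rightarrow> 'a poly \<Rightarrow> bool" where
  "splits_over L f \<longleftrightarrow>
     (\<exists>R. set_mset R \<subseteq> L \<and> f = smult (lead_coeff f) (\<Prod>x\<in>#R. [:- x, 1:]))"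

definition is_splitting_field :: "'a::field set \<Rightarrow> 'a set \<Rightarrow> 'a poly \<Rightarrow> bool" where
  "is_splitting_field K L f \<longleftrightarrow>
     is_subfield K \<and> is_subfield L \<and> K \<subseteq> L \<and> poly_over K f \<and> splits_over L f \<and>
     (\<forall>M. is_subfield M \<and> K \<subseteq> M \<and> {x\<in>L. poly f x = 0} \<subseteq> M \<longrightarrow> L \<subseteq> M)"

text \<open>Vectors of length \<open>n\<close> are elements of \<open>'a ^ 'n\<close> with \<open>CARD('n) = n\<close>.\<close>

definition hamming_weight :: "'a::zero ^ 'n \<Rightarrow> nat" where
  "hamming_weight x = card {i. x $ i \<noteq> 0}"

text \<open>Only meaningful if \<open>X\<close> contains a nonzero vector.\<close>

definition min_weight :: "('a::{zero,finite} ^ 'n) set \<Rightarrow> nat" where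
  "min_weight X = Min (hamming_weight ` (X - {0}))"

definition euclidean_dual :: "('a::comm_ring_1 ^ 'n) set \<Rightarrow> ('a ^ 'n) set" where
  "euclidean_dual C = {x. \<forall>y\<in>C. (\<Sum>i\<in>UNIV. x $ i * y $ i) = 0}"

definition ev :: "'a::comm_ring_1 ^ 'n \<Rightarrow> 'a ^ 'n \<Rightarrow> 'a poly \<Rightarrow> 'a ^ 'n" where
  "ev \<alpha> v f = (\<chi> i. v $ i * poly f (\<alpha> $ i))"

definition S1 :: "nat \<Rightarrow> 'a::field \<Rightarrow> 'a \<Rightarrow> 'a poly set" where
  "S1 n a b = (let m = (n - 1) div 2 in
     {(\<Sum>i<m. monom (f i) i) + smult (2 / b * f (m - 1)) (monom a m + monom 1 (m + 1)) | f. True})"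

text \<open>
  Operators on \<open>(\<complex>\<^sup>Q)\<^sup>\<otimes>\<^sup>n\<close>, where \<open>Q = CARD('a)\<close> and \<open>n = CARD('n)\<close>, are
  matrices whose rows and columns are indexed by the basis labels \<open>'a ^ 'n\<close>; the basis vector
  \<open>|x\<rangle>\<close> is \<open>axis x 1\<close>. The characteristic \<open>p\<close> of the field is \<open>CHAR('a)\<close>.
\<close>

type_synonym 'k cvec = "(complex, 'k) vec"
type_synonym 'k op = "((complex, 'k) vec, 'k) vec"

definition abs_trace :: "'a::finite_field \<Rightarrow> 'a" where
  "abs_trace x = (\<Sum>i < (THE m. CARD('a) = CHAR('a) ^ m). x ^ (CHAR('a) ^ i))"

definition zeta :: "'a::finite_field itself \<Rightarrow> complex" where
  "zeta _ = exp (2 * of_real pi * \<i> / of_nat CHAR('a))"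

text \<open>\<open>abs_trace x\<close> lies in the prime field; its representative in \<open>{0..<p}\<close> is the exponent.\<close>

definition trace_char :: "'a::finite_field \<Rightarrow> complex" where
  "trace_char x = zeta TYPE('a) ^ (THE k. k < CHAR('a) \<and> of_nat k = abs_trace x)"

definition X_op :: "'a::finite_field \<Rightarrow> 'a op" where
  "X_op a = (\<chi> y x. if y = x + a then 1 else 0)"

definition Z_op :: "'a::finite_field \<Rightarrow> 'a op" where
  "Z_op b = (\<chi> y x. if y = x then trace_char (b * x) else 0)"

definition tensor_op ::
    "('n \<Rightarrow> 'a op) \<Rightarrow> ('a::finite ^ 'n) op" where
  "tensor_op M = (\<chi> y x. \<Prod>i\<in>UNIV. M i $ (y $ i) $ (x $ i))"

definition scale_op :: "complex \<Rightarrow> 'k::finite op \<Rightarrow> 'k op" where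
  "scale_op z A = (\<chi> y x. z * A $ y $ x)"

definition error_op ::
    "nat \<Rightarrow> 'a::finite_field ^ 'n \<Rightarrow> 'a ^ 'n \<Rightarrow> ('a ^ 'n) op" where
  "error_op c a b = scale_op (zeta TYPE('a) ^ c)
     (tensor_op (\<lambda>i. X_op (a $ i)) ** tensor_op (\<lambda>i. Z_op (b $ i)))"

definition error_group :: "(('a::finite_field ^ 'n) op) set" where
  "error_group = {error_op c a b | c a b. True}"

definition error_weight :: "'a::zero ^ 'n \<Rightarrow> 'a ^ 'n \<Rightarrow> nat" where
  "error_weight a b = card {i. (a $ i, b $ i) \<noteq> (0, 0)}"

definition abelian_error_subgroup ::
    "(('a::finite_field ^ 'n) op) set \<Rightarrow> bool" where
  "abelian_error_subgroup G \<longleftrightarrow> G \<subseteq> error_group \<and> mat 1 \<in> G \<and>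
     (\<forall>A\<in>G. \<forall>B\<in>G. A ** B \<in> G \<and> A ** B = B ** A) \<and>
     (\<forall>A\<in>G. \<exists>B\<in>G. A ** B = mat 1 \<and> B ** A = mat 1)"

definition is_stabilizer_code :: "(('a::finite_field ^ 'n) cvec) set \<Rightarrow> bool" where
  "is_stabilizer_code V \<longleftrightarrow>
     (\<exists>G. abelian_error_subgroup G \<and> V = {\<psi>. \<forall>E\<in>G. E *v \<psi> = \<psi>}) \<and> V \<noteq> {0}"

definition is_orth_projector :: "'k::finite op \<Rightarrow> ('k cvec) set \<Rightarrow> bool" where
  "is_orth_projector P V \<longleftrightarrow>
     P ** P = P \<and> (\<forall>x y. P $ x $ y = cnj (P $ y $ x)) \<and> range ((*v) P) = V"

definition detectable :: "('k::finite cvec) set \<Rightarrow> 'k op \<Rightarrow> bool" where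
  "detectable V E \<longleftrightarrow> (\<exists>P c. is_orth_projector P V \<and> P ** E ** P = scale_op c P)"

definition detects_below :: "(('a::finite_field ^ 'n) cvec) set \<Rightarrow> nat \<Rightarrow> bool" where
  "detects_below V d \<longleftrightarrow>
     (\<forall>c a b. error_weight a b < d \<longrightarrow> detectable V (error_op c a b))"

definition has_min_distance :: "(('a::finite_field ^ 'n) cvec) set \<Rightarrow> nat \<Rightarrow> bool" where
  "has_min_distance V d \<longleftrightarrow> detects_below V d \<and> (\<forall>d'. detects_below V d' \<longrightarrow> d' \<le> d)"

text \<open>\<open>V\<close> is an \<open>[[n, K, d]]\<^sub>Q\<close> stabilizer code; \<open>vec.dim\<close> is the dimension over \<open>\<complex>\<close>.\<close>

definition stabilizer_code_params ::
    "(('a::finite_field ^ 'n) cvec) set \<Rightarrow> nat \<Rightarrow> nat \<Rightarrow> nat \<Rightarrow> nat \<Rightarrow> bool" where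
  "stabilizer_code_params V n K d Q \<longleftrightarrow>
     n = CARD('n) \<and> Q = CARD('a) \<and> is_stabilizer_code V \<and>
     vec.dim V = Q ^ K \<and> has_min_distance V d"

end

theory Submission
  imports Defs "HOL-Number_Theory.Cong"
begin

text \<open>
  For \<open>deg f < n\<close>, Lagrange interpolation at the roots of \<open>g\<close> shows that
  \<open>\<Sum>\<^sub>i f(\<alpha>\<^sub>i) / g'(\<alpha>\<^sub>i)\<close> is the coefficient of \<open>x\<^sup>n\<^sup>-\<^sup>1\<close> in \<open>f\<close>; reducing
  modulo \<open>g\<close> gives the values \<open>-a\<close> at \<open>x\<^sup>n\<close> and \<open>a\<^sup>2 - b\<close> at \<open>x\<^sup>n\<^sup>+\<^sup>1\<close>. This functional vanishes on all products
  of two elements of \<open>S\<^sub>1\<close>, so \<open>C\<^sub>1\<close> is self-orthogonal, of dimension \<open>(n - 1) / 2\<close>. The quantum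
  code is the CSS code stabilized by \<open>X(a)\<close> and \<open>Z(b)\<close> for \<open>a, b \<in> C\<^sub>1\<close>, i.e. the functions
  supported on \<open>C\<^sub>1\<^sup>\<bottom>\<close> that are constant on the cosets of \<open>C\<^sub>1\<close>. The roots \<open>v\<^sub>i\<close> exist since every
  element of \<open>F\<^sub>q\<close> is a square in the field of \<open>q\<^sup>2\<close> elements.
\<close>

subsection \<open>Finite fields\<close>

text \<open>Translation by 1 permutes the field, so the sum of all elements does not change when 1
  is added to each of them.\<close>

lemma CHAR_dvd_CARD_finite_field: "CHAR('a::finite_field) dvd CARD('a)"
proof -
  have "(\<Sum>x\<in>(UNIV::'a set). x + 1) = (\<Sum>x\<in>(UNIV::'a set). x)"
    by (rule sum.reindex_bij_witness[of _ "\<lambda>x. x - 1" "\<lambda>x. x + 1"]) auto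
  then have "of_nat CARD('a) = (0::'a)"
    by (simp add: sum.distrib)
  then show ?thesis
    by (simp add: of_nat_eq_0_iff_char_dvd)
qed

lemma CHAR_eq_of_CARD_prime_power:
  assumes "prime p" and "CARD('a::finite_field) = p ^ k"
  shows "CHAR('a) = p"
proof -
  have "CHAR('a) dvd p"
    using CHAR_dvd_CARD_finite_field[where 'a='a] assms
    by (metis CHAR_prime prime_dvd_power)
  then show ?thesis
    using assms(1) CHAR_prime[where 'a='a] by (metis primes_dvd_imp_eq)
qed

text \<open>The nonzero squares are the roots of \<open>x\<^sup>e - 1\<close>, \<open>e = (q\<^sup>2 - 1) / 2\<close>: they are such roots, and there are at least \<open>e\<close> of them.\<close>

lemma square_root_of_subfield_element:
  fixes y :: "'a::finite_field"
  assumes K: "y ^ q = y" and card: "CARD('a) = q ^ 2" and "odd q"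
  shows "\<exists>x. x ^ 2 = y"
proof (cases "y = 0")
  case False
  define e where "e = (q ^ 2 - 1) div 2"
  have q1: "q \<ge> 1" using \<open>odd q\<close> by (cases q) auto
  have "q \<noteq> 1"
  proof
    assume "q = 1"
    then have "CARD('a) = 1" using card by simp
    then show False
      by (metis card_1_singletonE iso_tuple_UNIV_I singletonD zero_neq_one)
  qed
  then have q3: "q \<ge> 3" using q1 \<open>odd q\<close> by (cases "q = 2") auto
  have e2: "2 * e = q ^ 2 - 1"
    using \<open>odd q\<close> by (simp add: e_def)
  have "q ^ 2 \<ge> 9" using power_mono[of 3 q 2] q3 by simp
  then have e_pos: "e > 0" using e2 by linarith
  have unit: "x ^ (q ^ 2 - 1) = 1" if "x \<noteq> 0" for x :: 'a
  proof -
    have "x * x ^ (q ^ 2 - 1) = x ^ (q ^ 2)"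
      using q1 by (metis power_eq_if not_one_le_zero power_not_zero)
    also have "\<dots> = x"
      using finite_field_power_card_eq_same[of x] card by simp
    finally show ?thesis using that by simp
  qed
  define A where "A = (UNIV - {0::'a})"
  define Sq where "Sq = (\<lambda>x. x ^ 2) ` A"
  define P where "P = (monom 1 e - 1 :: 'a poly)"
  have P_root: "poly P x = 0 \<longleftrightarrow> x ^ e = 1" for x
    by (simp add: P_def poly_monom)
  have "coeff P e = 1" using e_pos by (simp add: P_def)
  then have "P \<noteq> 0" by auto
  have "degree P \<le> e" unfolding P_def
    by (rule degree_diff_le) (auto simp: degree_monom_le)
  have card_roots: "card {x. poly P x = 0} \<le> e"
    using card_poly_roots_bound[OF \<open>P \<noteq> 0\<close>] \<open>degree P \<le> e\<close> by simp
  have sub: "Sq \<subseteq> {x. poly P x = 0}"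
    using unit e2 by (auto simp: Sq_def A_def P_root simp flip: power_mult)
  have "card A = (\<Sum>z\<in>Sq. card {x\<in>A. x ^ 2 = z})"
    using sum.image_gen[of A "\<lambda>_. 1::nat" "\<lambda>x. x ^ 2"] by (simp add: Sq_def)
  \<comment> \<open>Each fibre of the squaring map has at most two elements, \<open>w\<close> and
    \<open>- w\<close>.\<close>
  also have "\<dots> \<le> (\<Sum>z\<in>Sq. 2)"
  proof (rule sum_mono)
    fix z assume "z \<in> Sq"
    then obtain w where w: "z = w ^ 2" by (auto simp: Sq_def)
    have "{x \<in> A. x ^ 2 = z} \<subseteq> {w, - w}"
      by (auto simp: w power2_eq_iff)
    then have "card {x \<in> A. x ^ 2 = z} \<le> card {w, - w}"
      by (intro card_mono) auto
    also have "\<dots> \<le> 2" by (simp add: card_insert_if)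
    finally show "card {x \<in> A. x ^ 2 = z} \<le> 2" .
  qed
  finally have "card A \<le> 2 * card Sq" by simp
  moreover have "card A = q ^ 2 - 1"
    by (simp add: A_def card)
  ultimately have "e \<le> card Sq" using e2 by linarith
  then have Sq_eq: "Sq = {x. poly P x = 0}"
    using sub card_roots by (intro card_seteq) auto
  have yq: "y ^ (q - 1) = 1"
  proof -
    have "y * y ^ (q - 1) = y ^ q" using q1 by (metis power_eq_if not_one_le_zero)
    then show ?thesis using K False by simp
  qed
  \<comment> \<open>Since \<open>q + 1\<close> is even, \<open>e\<close> is a multiple of
    \<open>q - 1\<close>, and \<open>y ^ (q - 1) = 1\<close> carries over to the exponent
    \<open>e\<close>.\<close>
  have "e = (q - 1) * ((q + 1) div 2)"
  proof -
    obtain k where k: "q = 2 * k + 1" using \<open>odd q\<close> by (auto elim: oddE)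
    have "2 * e = 2 * ((q - 1) * ((q + 1) div 2))"
      unfolding e2 by (simp add: k power2_eq_square algebra_simps)
    then show ?thesis by simp
  qed
  then have "y ^ e = 1" by (simp only: power_mult yq power_one)
  then have "y \<in> Sq" by (simp add: Sq_eq P_root)
  then show ?thesis by (auto simp: Sq_def)
qed auto

text \<open>Fermat's argument: multiplication by a nonzero \<open>x\<close> permutes
  \<open>K - {0}\<close>, and the product over this set cancels.\<close>

lemma power_card_subfield_eq_same:
  fixes K :: "'a::finite_field set"
  assumes K: "is_subfield K" and x: "x \<in> K"
  shows "x ^ card K = x"
proof (cases "x = 0")
  case False
  have closed: "y * z \<in> K" "inverse y \<in> K" if "y \<in> K" "z \<in> K" for y z
    using K that by (auto simp: is_subfield_def)
  have "0 \<in> K" using K by (simp add: is_subfield_def)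
  then have pos: "card K > 0" by (auto simp: card_gt_0_iff)
  have "\<Prod>(K - {0}) = (\<Prod>y\<in>K - {0}. x * y)"
    by (rule prod.reindex_bij_witness[of _ "\<lambda>y. x * y" "\<lambda>y. inverse x * y"])
      (use False x closed in auto)
  also have "\<dots> = x ^ (card K - 1) * \<Prod>(K - {0})"
    using \<open>0 \<in> K\<close> by (simp add: prod.distrib card_Diff_singleton)
  finally have "x ^ (card K - 1) = 1" by simp
  then have "x * x ^ (card K - 1) = x" by simp
  then show ?thesis using pos by (metis power_eq_if gr_implies_not0)
next
  case True
  moreover have "card K > 0" using x by (auto simp: card_gt_0_iff)
  ultimately show ?thesis by simp
qed

lemma root_in_splitting_set:
  assumes "splits_over L f" and "f \<noteq> 0" and "poly f x = 0"
  shows "x \<in> L"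
proof -
  obtain R where R: "set_mset R \<subseteq> L" "f = smult (lead_coeff f) (\<Prod>y\<in>#R. [:- y, 1:])"
    using assms(1) by (auto simp: splits_over_def)
  have "poly (\<Prod>y\<in>#R. [:- y, 1:]) x = 0"
    using assms(2,3) R(2) by (metis poly_smult mult_eq_0_iff leading_coeff_0_iff)
  then have "x \<in># R" by (induction R) auto
  then show ?thesis using R(1) by blast
qed

lemma prod_in_subfield:
  assumes "is_subfield K" and "\<And>i. i \<in> I \<Longrightarrow> f i \<in> K"
  shows "(\<Prod>i\<in>I. f i) \<in> K"
  using assms(2)
  by (induction I rule: infinite_finite_induct) (use assms(1) in \<open>auto simp: is_subfield_def\<close>)

subsection \<open>Additive characters\<close>

text \<open>Powers of the prime \<open>CHAR('a)\<close> determine their exponent, so the description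
  in \<open>abs_trace\<close> denotes \<open>N\<close>. The facts on characters below take the same
  equation as a premise.\<close>

lemma abs_trace_eq:
  fixes x :: "'a::finite_field"
  assumes "CARD('a) = CHAR('a) ^ N"
  shows "abs_trace x = (\<Sum>i<N. x ^ (CHAR('a) ^ i))"
proof -
  have "(THE m. CARD('a) = CHAR('a) ^ m) = N"
  proof (rule the_equality)
    fix m assume "CARD('a) = CHAR('a) ^ m"
    then have "CHAR('a) ^ m = CHAR('a) ^ N" using assms by simp
    then show "m = N"
      using prime_gt_1_nat[OF CHAR_prime[where 'a='a]] by (simp add: power_inject_exp)
  qed (rule assms)
  then show ?thesis by (simp add: abs_trace_def)
qed

lemma abs_trace_add:
  fixes x y :: "'a::finite_field"
  assumes "CARD('a) = CHAR('a) ^ N"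
  shows "abs_trace (x + y) = abs_trace x + abs_trace y"
  by (simp add: abs_trace_eq[OF assms] sum.distrib freshmans_dream'[OF CHAR_prime refl])

text \<open>Frobenius shifts the summands by one place, and the last one wraps around to
  \<open>x\<close> because \<open>x ^ CARD('a) = x\<close>. Hence the trace lies in the prime
  field.\<close>

lemma abs_trace_frobenius:
  fixes x :: "'a::finite_field"
  assumes "CARD('a) = CHAR('a) ^ N"
  shows "abs_trace x ^ CHAR('a) = abs_trace x"
proof -
  let ?p = "CHAR('a)"
  have "abs_trace x ^ ?p = (\<Sum>i<N. x ^ (?p ^ Suc i))"
    by (simp add: abs_trace_eq[OF assms] freshmans_dream_sum[OF CHAR_prime refl] mult.commute
      flip: power_mult)
  also have "\<dots> = (\<Sum>i<Suc N. x ^ (?p ^ i)) - x"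
    by (subst sum.lessThan_Suc_shift) simp
  also have "\<dots> = abs_trace x"
    using finite_field_power_card_eq_same[of x] by (simp add: abs_trace_eq[OF assms] flip: assms)
  finally show ?thesis .
qed

text \<open>Otherwise a nonzero polynomial of degree at most \<open>CHAR('a) ^ (N - 1)\<close> would
  vanish on the whole field.\<close>

lemma exists_abs_trace_nonzero:
  assumes "CARD('a::finite_field) = CHAR('a) ^ N"
  shows "\<exists>x::'a. abs_trace x \<noteq> 0"
proof (rule ccontr)
  assume "\<not> ?thesis"
  then have tr0: "abs_trace x = 0" for x :: 'a by auto
  let ?p = "CHAR('a)"
  have p1: "?p > 1" using prime_gt_1_nat[OF CHAR_prime] .
  define P where "P = (\<Sum>i<N. monom (1::'a) (?p ^ i))"
  have "N \<noteq> 0"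
  proof
    assume "N = 0"
    then have "CARD('a) = 1" using assms by simp
    then show False
      by (metis card_1_singletonE iso_tuple_UNIV_I singletonD zero_neq_one)
  qed
  then obtain M where M: "N = Suc M" by (cases N) auto
  have deg: "degree P \<le> ?p ^ M" unfolding P_def M
    using p1 by (intro degree_sum_le) (auto intro!: order.trans[OF degree_monom_le] power_increasing)
  have "coeff P (?p ^ M) = (\<Sum>i<N. if i = M then 1 else 0)"
    unfolding P_def coeff_sum coeff_monom using p1 by (intro sum.cong) (auto simp: power_inject_exp)
  then have "coeff P (?p ^ M) = 1" by (simp add: M)
  then have "P \<noteq> 0" by auto
  have "{x. poly P x = 0} = UNIV"
    using tr0 by (auto simp: P_def poly_sum poly_monom abs_trace_eq[OF assms])
  then have "?p ^ N \<le> ?p ^ M"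
    using card_poly_roots_bound[OF \<open>P \<noteq> 0\<close>] deg assms by simp
  then show False using p1 by (simp add: M)
qed

lemma of_nat_frobenius: "(of_nat k :: 'a::finite_field) ^ CHAR('a) = of_nat k"
proof (induction k)
  case 0
  then show ?case by (simp add: power_0_left)
next
  case (Suc k)
  then show ?case by (simp add: freshmans_dream[OF CHAR_prime refl])
qed

lemma of_nat_eq_iff_mod_CHAR:
  "(of_nat k :: 'a::finite_field) = of_nat l \<longleftrightarrow> k mod CHAR('a) = l mod CHAR('a)"
  using of_nat_eq_iff_cong_CHAR[where 'a='a] by (simp add: cong_def)

text \<open>The images of \<open>0, ..., p - 1\<close> are already \<open>p\<close> roots of
  \<open>x^p - x\<close>, so there are no others. This supplies the exponent that
  \<open>trace_char\<close> describes.\<close>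

lemma frobenius_fixed_imp_of_nat:
  fixes y :: "'a::finite_field"
  assumes "y ^ CHAR('a) = y"
  shows "\<exists>k<CHAR('a). of_nat k = y"
proof -
  let ?p = "CHAR('a)"
  have p1: "?p > 1" using prime_gt_1_nat[OF CHAR_prime] .
  define P where "P = (monom 1 ?p - monom 1 1 :: 'a poly)"
  have P_root: "poly P x = 0 \<longleftrightarrow> x ^ ?p = x" for x
    by (simp add: P_def poly_monom)
  have "coeff P ?p = 1" using p1 by (simp add: P_def)
  then have "P \<noteq> 0" by auto
  have "degree P \<le> ?p" unfolding P_def
    using p1 by (intro degree_diff_le) (auto intro!: order.trans[OF degree_monom_le])
  then have card_roots: "card {x. poly P x = 0} \<le> ?p"
    using card_poly_roots_bound[OF \<open>P \<noteq> 0\<close>] by simp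
  have "inj_on (of_nat :: nat \<Rightarrow> 'a) {..<?p}"
    by (auto simp: inj_on_def of_nat_eq_iff_mod_CHAR)
  then have "card ((of_nat :: nat \<Rightarrow> 'a) ` {..<?p}) = ?p"
    by (simp add: card_image)
  moreover have "(of_nat :: nat \<Rightarrow> 'a) ` {..<?p} \<subseteq> {x. poly P x = 0}"
    by (auto simp: P_root of_nat_frobenius)
  ultimately have "(of_nat :: nat \<Rightarrow> 'a) ` {..<?p} = {x. poly P x = 0}"
    using card_roots by (intro card_seteq) auto
  moreover have "y \<in> {x. poly P x = 0}" using assms by (simp add: P_root)
  ultimately show ?thesis by (metis imageE lessThan_iff)
qed

lemma zeta_power: "zeta TYPE('a::finite_field) ^ k = cis (2 * pi * k / CHAR('a))"
proof -
  have "zeta TYPE('a) = cis (2 * pi / CHAR('a))"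
    by (simp add: zeta_def cis_conv_exp mult_ac)
  then show ?thesis by (simp add: Complex.DeMoivre mult_ac)
qed

lemma zeta_power_CHAR: "zeta TYPE('a::finite_field) ^ CHAR('a) = 1"
  by (simp add: zeta_power)

lemma zeta_power_mod: "zeta TYPE('a::finite_field) ^ (k mod CHAR('a)) = zeta TYPE('a) ^ k"
proof -
  have "zeta TYPE('a) ^ k = zeta TYPE('a) ^ (CHAR('a) * (k div CHAR('a)) + k mod CHAR('a))"
    by simp
  also have "\<dots> = zeta TYPE('a) ^ (k mod CHAR('a))"
    by (simp only: power_add power_mult zeta_power_CHAR power_one mult_1_left)
  finally show ?thesis ..
qed

text \<open>Frees \<open>trace_char\<close> from the reduced representative: exponents of
  \<open>zeta\<close> count only modulo the characteristic, so exponents may be added without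
  reduction.\<close>

lemma trace_char_eq:
  fixes x :: "'a::finite_field"
  assumes "of_nat k = abs_trace x"
  shows "trace_char x = zeta TYPE('a) ^ k"
proof -
  have "(THE j. j < CHAR('a) \<and> of_nat j = abs_trace x) = k mod CHAR('a)"
    by (rule the_equality) (auto simp: of_nat_eq_iff_mod_CHAR simp flip: assms)
  then show ?thesis by (simp add: trace_char_def zeta_power_mod)
qed

lemma trace_char_add:
  fixes x y :: "'a::finite_field"
  assumes "CARD('a) = CHAR('a) ^ N"
  shows "trace_char (x + y) = trace_char x * trace_char y"
proof -
  obtain k l where k: "of_nat k = abs_trace x" and l: "of_nat l = abs_trace y"
    using frobenius_fixed_imp_of_nat[OF abs_trace_frobenius[OF assms]] by metis
  have "of_nat (k + l) = abs_trace (x + y)"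
    by (simp add: abs_trace_add[OF assms] k l)
  then show ?thesis
    by (simp add: trace_char_eq[OF k] trace_char_eq[OF l] trace_char_eq[of "k + l"] power_add)
qed

lemma trace_char_0:
  assumes "CARD('a::finite_field) = CHAR('a) ^ N"
  shows "trace_char (0::'a) = 1"
proof -
  have "abs_trace (0::'a) = 0" using abs_trace_add[OF assms, of 0 0] by (metis add_0 add_cancel_left_left)
  then show ?thesis using trace_char_eq[of 0 "0::'a"] by simp
qed

lemma trace_char_nontrivial:
  assumes "CARD('a::finite_field) = CHAR('a) ^ N"
  shows "\<exists>x::'a. trace_char x \<noteq> 1"
proof -
  obtain x :: 'a where x: "abs_trace x \<noteq> 0"
    using exists_abs_trace_nonzero[OF assms] by blast
  obtain k where k: "k < CHAR('a)" "of_nat k = abs_trace x"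
    using frobenius_fixed_imp_of_nat[OF abs_trace_frobenius[OF assms]] by metis
  have "k \<noteq> 0" using x k by (metis of_nat_0)
  have "zeta TYPE('a) ^ k \<noteq> 1"
  proof
    assume "zeta TYPE('a) ^ k = 1"
    \<comment> \<open>The real part alone suffices: cosine is 1 only at integer multiples of
      \<open>2 * pi\<close>.\<close>
    then have "cos (2 * pi * k / CHAR('a)) = 1"
      by (simp add: zeta_power cis.code complex_eq_iff)
    then obtain j :: int where "2 * pi * k / CHAR('a) = 2 * pi * j"
      unfolding cos_one_2pi_int by (auto simp: mult_ac)
    then have "real k = j * CHAR('a)" by (simp add: field_simps)
    then have "int k = j * int CHAR('a)"
      by (metis of_int_eq_iff of_int_mult of_int_of_nat_eq)
    then have "CHAR('a) dvd k"
      by (metis dvd_triv_right int_dvd_int_iff)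
    then show False using k \<open>k \<noteq> 0\<close> by (simp add: nat_dvd_not_less)
  qed
  then show ?thesis using trace_char_eq[OF k(2)] by metis
qed

lemma trace_char_sum:
  fixes f :: "'i \<Rightarrow> 'a::finite_field"
  assumes "CARD('a) = CHAR('a) ^ N"
  shows "trace_char (\<Sum>i\<in>I. f i) = (\<Prod>i\<in>I. trace_char (f i))"
  by (induction I rule: infinite_finite_induct)
    (simp_all add: trace_char_add[OF assms] trace_char_0[OF assms])

section \<open>Characters of the vector space and Euclidean duality\<close>

text \<open>The additive character attached to \<open>b\<close>; its value at \<open>x\<close> is
  the diagonal entry of \<open>Z(b)\<close> at the basis label \<open>x\<close>.\<close>

definition vec_char :: "'a::finite_field ^ 'n \<Rightarrow> 'a ^ 'n \<Rightarrow> complex" where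
  "vec_char b x = trace_char (\<Sum>i\<in>UNIV. b $ i * x $ i)"

lemma vec_char_add_right:
  fixes b x y :: "'a::finite_field ^ 'n"
  assumes "CARD('a) = CHAR('a) ^ N"
  shows "vec_char b (x + y) = vec_char b x * vec_char b y"
  by (simp add: vec_char_def distrib_left sum.distrib trace_char_add[OF assms])

lemma vec_char_commute: "vec_char b x = vec_char x b"
  by (simp add: vec_char_def mult.commute)

lemma vec_char_add_left:
  fixes b c x :: "'a::finite_field ^ 'n"
  assumes "CARD('a) = CHAR('a) ^ N"
  shows "vec_char (b + c) x = vec_char b x * vec_char c x"
  by (simp add: vec_char_commute[of _ x] vec_char_add_right[OF assms])

lemma vec_char_zero_left:
  assumes "CARD('a::finite_field) = CHAR('a) ^ N"
  shows "vec_char (0 :: 'a ^ 'n) x = 1"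
  by (simp add: vec_char_def trace_char_0[OF assms])

lemma vec_char_dual:
  fixes C :: "('a::finite_field ^ 'n) set"
  assumes "CARD('a) = CHAR('a) ^ N" and "x \<in> euclidean_dual C" and "b \<in> C"
  shows "vec_char b x = 1"
  using assms(2,3) trace_char_0[OF assms(1)]
  by (simp add: euclidean_dual_def vec_char_def mult.commute)

text \<open>Linearity of \<open>C\<close> over the whole field enters here: a word \<open>y\<close>
  of \<open>C\<close> with nonzero product with \<open>x\<close> is scaled until the product is an
  element \<open>t\<close> of nontrivial character.\<close>

lemma vec_char_nontrivial:
  fixes C :: "('a::finite_field ^ 'n) set"
  assumes card: "CARD('a) = CHAR('a) ^ N" and C: "vec.subspace C" and "x \<notin> euclidean_dual C"
  shows "\<exists>b\<in>C. vec_char b x \<noteq> 1"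
proof -
  obtain y where y: "y \<in> C" "(\<Sum>i\<in>UNIV. x $ i * y $ i) \<noteq> 0"
    using assms(3) by (auto simp: euclidean_dual_def)
  obtain t :: 'a where t: "trace_char t \<noteq> 1"
    using trace_char_nontrivial[OF card] by blast
  define e where "e = t / (\<Sum>i\<in>UNIV. x $ i * y $ i)"
  have "(\<Sum>i\<in>UNIV. (e *s y) $ i * x $ i) = e * (\<Sum>i\<in>UNIV. x $ i * y $ i)"
    by (simp add: sum_distrib_left mult_ac)
  then have "vec_char (e *s y) x = trace_char t"
    using y(2) by (simp add: vec_char_def e_def)
  then show ?thesis
    using t vec.subspace_scale[OF C y(1)] by metis
qed

text \<open>Orthogonality of characters: translating the sum by some \<open>b\<close> in
  \<open>C\<close> multiplies it by a factor other than 1 unless the character is trivial on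
  \<open>C\<close>.\<close>

lemma sum_vec_char_subspace:
  fixes C :: "('a::finite_field ^ 'n) set"
  assumes card: "CARD('a) = CHAR('a) ^ N" and C: "vec.subspace C"
  shows "(\<Sum>w\<in>C. vec_char x w) = (if x \<in> euclidean_dual C then of_nat (card C) else 0)"
proof (cases "x \<in> euclidean_dual C")
  case True
  then have "(\<Sum>w\<in>C. vec_char x w) = (\<Sum>w\<in>C. 1)"
    by (intro sum.cong) (auto simp: vec_char_commute[of x] vec_char_dual[OF card])
  then show ?thesis using True by simp
next
  case False
  then obtain b where b: "b \<in> C" "vec_char x b \<noteq> 1"
    using vec_char_nontrivial[OF card C] by (metis vec_char_commute)
  have "(\<Sum>w\<in>C. vec_char x w) = (\<Sum>w\<in>C. vec_char x (w + b))"
    by (rule sum.reindex_bij_witness[of _ "\<lambda>w. w + b" "\<lambda>w. w - b"])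
      (auto simp: vec.subspace_add[OF C] vec.subspace_diff[OF C] b(1))
  also have "\<dots> = vec_char x b * (\<Sum>w\<in>C. vec_char x w)"
    by (simp add: vec_char_add_right[OF card] sum_distrib_left mult.commute)
  finally show ?thesis using b(2) False by simp
qed

text \<open>Double counting of the sum of all characters \<open>vec_char x w\<close> with \<open>w \<in> C\<close>.\<close>

lemma card_euclidean_dual:
  fixes C :: "('a::finite_field ^ 'n) set"
  assumes card: "CARD('a) = CHAR('a) ^ N" and C: "vec.subspace C"
  shows "card C * card (euclidean_dual C) = CARD('a) ^ CARD('n)"
proof -
  \<comment> \<open>Pairing with unit vectors shows that only 0 is orthogonal to everything, so
    after the sums are swapped only \<open>w = 0\<close> contributes.\<close>
  have dual_UNIV: "w \<in> euclidean_dual UNIV \<longleftrightarrow> w = 0" for w :: "'a ^ 'n"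
  proof
    assume w: "w \<in> euclidean_dual UNIV"
    have "w $ j = 0" for j
    proof -
      have "(\<Sum>i\<in>UNIV. w $ i * axis j 1 $ i) = 0"
        using w unfolding euclidean_dual_def by blast
      moreover have "(\<Sum>i\<in>UNIV. w $ i * axis j 1 $ i) = (\<Sum>i\<in>UNIV. if i = j then w $ i else 0)"
        by (intro sum.cong) (auto simp: axis_def)
      ultimately show ?thesis by simp
    qed
    then show "w = 0" by (simp add: vec_eq_iff)
  qed (simp add: euclidean_dual_def)
  have "of_nat (card C * card (euclidean_dual C)) =
      (\<Sum>x\<in>UNIV. if x \<in> euclidean_dual C then of_nat (card C) else (0::complex))"
    by (simp add: sum.If_cases)
  also have "\<dots> = (\<Sum>x\<in>UNIV. \<Sum>w\<in>C. vec_char x w)"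
    by (simp add: sum_vec_char_subspace[OF card C])
  also have "\<dots> = (\<Sum>w\<in>C. \<Sum>x\<in>UNIV. vec_char w x)"
    by (subst sum.swap) (simp add: vec_char_commute)
  also have "\<dots> = (\<Sum>w\<in>C. if w = 0 then of_nat CARD('a ^ 'n) else 0)"
    using sum_vec_char_subspace[OF card vec.subspace_UNIV, where 'n='n]
    by (intro sum.cong) (auto simp: dual_UNIV)
  also have "\<dots> = of_nat (CARD('a) ^ CARD('n))"
    using vec.subspace_0[OF C] by simp
  finally show ?thesis by (simp only: of_nat_eq_iff)
qed

lemma subspace_euclidean_dual: "vec.subspace (euclidean_dual C)"
proof -
  have "(\<Sum>i\<in>UNIV. (e *s x) $ i * y $ i) = e * (\<Sum>i\<in>UNIV. x $ i * y $ i)" for e x and y :: "'a ^ 'b"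
    by (simp add: sum_distrib_left mult_ac)
  then show ?thesis
    by (auto simp: vec.subspace_def euclidean_dual_def distrib_right sum.distrib)
qed

section \<open>Error operators as monomial matrices\<close>

text \<open>The tensor product of the \<open>X_op\<close> is a permutation matrix and that of the
  \<open>Z_op\<close> is diagonal, so each column of the product has a single nonzero entry.\<close>

lemma error_op_entry:
  fixes a b :: "'a::finite_field ^ 'n"
  assumes "CARD('a) = CHAR('a) ^ N"
  shows "error_op c a b $ y $ x = (if y = x + a then zeta TYPE('a) ^ c * vec_char b x else 0)"
proof -
  have X: "tensor_op (\<lambda>i. X_op (a $ i)) $ y $ u = (if u = y - a then 1 else 0)" for u
  proof (cases "y = u + a")
    case False
    then obtain i where "y $ i \<noteq> u $ i + a $ i" by (auto simp: vec_eq_iff)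
    then have "\<exists>i. X_op (a $ i) $ (y $ i) $ (u $ i) = 0"
      by (intro exI[of _ i]) (simp add: X_op_def)
    then have "(\<Prod>i\<in>UNIV. X_op (a $ i) $ (y $ i) $ (u $ i)) = 0" by (simp add: prod_zero)
    then show ?thesis using False by (auto simp: tensor_op_def)
  qed (simp add: tensor_op_def X_op_def)
  have Z: "tensor_op (\<lambda>i. Z_op (b $ i)) $ u $ x = (if u = x then vec_char b x else 0)" for u
  proof (cases "u = x")
    case False
    then obtain i where "u $ i \<noteq> x $ i" by (auto simp: vec_eq_iff)
    then have "\<exists>i. Z_op (b $ i) $ (u $ i) $ (x $ i) = 0"
      by (intro exI[of _ i]) (simp add: Z_op_def)
    then have "(\<Prod>i\<in>UNIV. Z_op (b $ i) $ (u $ i) $ (x $ i)) = 0" by (simp add: prod_zero)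
    then show ?thesis using False by (auto simp: tensor_op_def)
  qed (simp add: tensor_op_def Z_op_def vec_char_def trace_char_sum[OF assms])
  have "(\<Sum>u\<in>UNIV. tensor_op (\<lambda>i. X_op (a $ i)) $ y $ u * tensor_op (\<lambda>i. Z_op (b $ i)) $ u $ x)
      = (\<Sum>u\<in>UNIV. if u = x then (if y = x + a then vec_char b x else 0) else 0)"
    by (intro sum.cong) (auto simp: X Z)
  then show ?thesis
    by (simp add: error_op_def scale_op_def matrix_matrix_mult_def)
qed

lemma error_op_mult_vec:
  fixes a b :: "'a::finite_field ^ 'n"
  assumes "CARD('a) = CHAR('a) ^ N"
  shows "(error_op c a b *v \<psi>) $ y = zeta TYPE('a) ^ c * vec_char b (y - a) * \<psi> $ (y - a)"
proof -
  have "(error_op c a b *v \<psi>) $ y =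
      (\<Sum>x\<in>UNIV. if x = y - a then zeta TYPE('a) ^ c * vec_char b x * \<psi> $ x else 0)"
    unfolding matrix_vector_mult_def
    unfolding vec_lambda_beta
    by (intro sum.cong) (auto simp: error_op_entry[OF assms])
  then show ?thesis by simp
qed

subsection \<open>CSS codes\<close>

definition css_code :: "('a::finite_field ^ 'n) set \<Rightarrow> (('a ^ 'n) cvec) set" where
  "css_code C = {\<psi>. (\<forall>x. \<psi> $ x \<noteq> 0 \<longrightarrow> x \<in> euclidean_dual C) \<and> (\<forall>x. \<forall>w\<in>C. \<psi> $ (x + w) = \<psi> $ x)}"

text \<open>Averaging over cosets of \<open>C\<close>, cut off outside the dual. The support
  condition mentions only the column index; for self-orthogonal \<open>C\<close> it passes to the
  row index because \<open>y - x\<close> lies in \<open>C\<close>.\<close>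

definition css_projector :: "('a::finite_field ^ 'n) set \<Rightarrow> ('a ^ 'n) op" where
  "css_projector C = (\<chi> y x. if x \<in> euclidean_dual C \<and> y - x \<in> C then 1 / of_nat (card C) else 0)"

locale self_orthogonal_code =
  fixes C :: "('a::finite_field ^ 'n) set" and N :: nat
  assumes card_field: "CARD('a) = CHAR('a) ^ N"
    and subspace: "vec.subspace C"
    and self_orthogonal: "C \<subseteq> euclidean_dual C"
begin

lemmas closed = vec.subspace_0[OF subspace] vec.subspace_add[OF subspace]
  vec.subspace_diff[OF subspace] vec.subspace_neg[OF subspace]

lemmas dual_closed = vec.subspace_0[OF subspace_euclidean_dual, of C]
  vec.subspace_add[OF subspace_euclidean_dual, of _ C]
  vec.subspace_diff[OF subspace_euclidean_dual, of _ C]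
  vec.subspace_neg[OF subspace_euclidean_dual, of _ C]

lemma nonempty: "C \<noteq> {}"
  using closed(1) by blast

lemma card_pos: "card C > 0"
  using nonempty by (simp add: card_gt_0_iff)

lemma dual_add_iff: "w \<in> C \<Longrightarrow> x + w \<in> euclidean_dual C \<longleftrightarrow> x \<in> euclidean_dual C"
  using dual_closed(2)[of x w] dual_closed(3)[of "x + w" w] self_orthogonal by auto

lemma add_iff: "w \<in> C \<Longrightarrow> x + w \<in> C \<longleftrightarrow> x \<in> C"
  using closed(2)[of x w] closed(3)[of "x + w" w] by auto

lemma vec_char_code: "x \<in> euclidean_dual C \<Longrightarrow> b \<in> C \<Longrightarrow> vec_char b x = 1"
  by (rule vec_char_dual[OF card_field])

lemma error_op_0: "error_op 0 (0 :: 'a ^ 'n) 0 = mat 1"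
  by (simp add: vec_eq_iff error_op_entry[OF card_field] mat_def vec_char_zero_left[OF card_field])

text \<open>Moving \<open>Z(b)\<close> past \<open>X(a')\<close> costs the phase
  \<open>vec_char b a'\<close>, which is 1 because \<open>C\<close> is self-orthogonal.\<close>

lemma error_op_mult:
  assumes "a \<in> C" "b \<in> C" "a' \<in> C" "b' \<in> C"
  shows "error_op 0 a b ** error_op 0 a' b' = error_op 0 (a + a') (b + b')"
proof -
  have "(\<Sum>u\<in>UNIV. error_op 0 a b $ y $ u * error_op 0 a' b' $ u $ x)
      = error_op 0 (a + a') (b + b') $ y $ x" for y x
  proof -
    have "(\<Sum>u\<in>UNIV. error_op 0 a b $ y $ u * error_op 0 a' b' $ u $ x)
      = (\<Sum>u\<in>UNIV. if u = x + a' then error_op 0 a b $ y $ u * vec_char b' x else 0)"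
      by (intro sum.cong) (auto simp: error_op_entry[OF card_field])
    also have "\<dots> = error_op 0 (a + a') (b + b') $ y $ x"
      using vec_char_code[of a' b] assms self_orthogonal
      by (auto simp: error_op_entry[OF card_field] vec_char_add_left[OF card_field]
        vec_char_add_right[OF card_field] add_ac)
    finally show ?thesis .
  qed
  then show ?thesis by (simp add: vec_eq_iff matrix_matrix_mult_def)
qed

text \<open>By \<open>error_op_mult\<close> no phases arise, so the exponent 0 is enough and the
  group laws are inherited from addition in \<open>C\<close>.\<close>

lemma abelian_error_subgroup_css:
  "abelian_error_subgroup {error_op 0 a b | a b. a \<in> C \<and> b \<in> C}" (is "abelian_error_subgroup ?G")
  unfolding abelian_error_subgroup_def
proof (intro conjI ballI)
  show "?G \<subseteq> error_group" by (auto simp: error_group_def)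
  show "mat 1 \<in> ?G" using error_op_0 closed(1) by (auto intro!: exI[of _ "0 :: 'a ^ 'n"])
next
  fix A B assume "A \<in> ?G" "B \<in> ?G"
  then obtain a b a' b' where *: "A = error_op 0 a b" "B = error_op 0 a' b'"
    "a \<in> C" "b \<in> C" "a' \<in> C" "b' \<in> C" by auto
  then show "A ** B \<in> ?G" using closed(2) by (auto simp: error_op_mult)
  show "A ** B = B ** A" using * by (simp add: error_op_mult add.commute)
next
  fix A assume "A \<in> ?G"
  then obtain a b where *: "A = error_op 0 a b" "a \<in> C" "b \<in> C" by auto
  then have "A ** error_op 0 (- a) (- b) = mat 1" "error_op 0 (- a) (- b) ** A = mat 1"
    using closed(4) by (simp_all add: error_op_mult error_op_0)
  then show "\<exists>B\<in>?G. A ** B = mat 1 \<and> B ** A = mat 1"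
    using * closed(4) by blast
qed

text \<open>Invariance under \<open>X(a)\<close> is constancy on cosets of \<open>C\<close>;
  invariance under \<open>Z(b)\<close> confines the support to the dual.\<close>

lemma css_code_eq_fixed:
  "css_code C = {\<psi>. \<forall>E\<in>{error_op 0 a b | a b. a \<in> C \<and> b \<in> C}. E *v \<psi> = \<psi>}"
proof (intro equalityI subsetI)
  fix \<psi> assume \<psi>: "\<psi> \<in> css_code C"
  have "(error_op 0 a b *v \<psi>) $ y = \<psi> $ y" if "a \<in> C" "b \<in> C" for a b y
  proof -
    have "\<psi> $ (y - a) = \<psi> $ y"
      using \<psi> that(1) by (auto simp: css_code_def) (metis diff_add_cancel)
    moreover have "vec_char b (y - a) = 1" if "\<psi> $ (y - a) \<noteq> 0"
      using \<psi> that \<open>b \<in> C\<close> by (auto simp: css_code_def intro: vec_char_code)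
    ultimately show ?thesis
      by (cases "\<psi> $ y = 0") (auto simp: error_op_mult_vec[OF card_field])
  qed
  then have "error_op 0 a b *v \<psi> = \<psi>" if "a \<in> C" "b \<in> C" for a b
    using that by (simp add: vec_eq_iff)
  then show "\<psi> \<in> {\<psi>. \<forall>E\<in>{error_op 0 a b | a b. a \<in> C \<and> b \<in> C}. E *v \<psi> = \<psi>}"
    by blast
next
  fix \<psi> assume "\<psi> \<in> {\<psi>. \<forall>E\<in>{error_op 0 a b | a b. a \<in> C \<and> b \<in> C}. E *v \<psi> = \<psi>}"
  then have "error_op 0 a b *v \<psi> = \<psi>" if "a \<in> C" "b \<in> C" for a b using that by blast
  then have fixed: "vec_char b (y - a) * \<psi> $ (y - a) = \<psi> $ y" if "a \<in> C" "b \<in> C" for a b y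
    using that by (metis error_op_mult_vec[OF card_field] mult_1 power_0)
  \<comment> \<open>Taking \<open>a = 0\<close>, every character from \<open>C\<close> must be 1 at
    a point of the support; outside the dual some character is not.\<close>
  have "x \<in> euclidean_dual C" if "\<psi> $ x \<noteq> 0" for x
    using fixed[OF closed(1), of _ x] that vec_char_nontrivial[OF card_field subspace, of x] by auto
  moreover have "\<psi> $ (x + w) = \<psi> $ x" if "w \<in> C" for x w
    using fixed[OF that closed(1), of "x + w"] by (simp add: vec_char_zero_left[OF card_field])
  ultimately show "\<psi> \<in> css_code C" by (auto simp: css_code_def)
qed

section \<open>The projector onto the code\<close>

text \<open>The central computation, used both for idempotence and for detectability. The sum over a
  coset of \<open>C\<close> produces the sum of \<open>vec_char b\<close> over \<open>C\<close>,
  which vanishes unless \<open>b\<close> is in the dual.\<close>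

lemma css_projector_error_op:
  "(css_projector C ** error_op c a b ** css_projector C) $ y $ x =
    (if x \<in> euclidean_dual C \<and> b \<in> euclidean_dual C
     then zeta TYPE('a) ^ c * vec_char b x * css_projector C $ y $ (x + a) else 0)"
proof -
  let ?P = "css_projector C"
  have PE: "(?P ** error_op c a b) $ y $ v = ?P $ y $ (v + a) * zeta TYPE('a) ^ c * vec_char b v" for v
  proof -
    have "(\<Sum>u\<in>UNIV. ?P $ y $ u * error_op c a b $ u $ v)
      = (\<Sum>u\<in>UNIV. if u = v + a then ?P $ y $ u * zeta TYPE('a) ^ c * vec_char b v else 0)"
      by (intro sum.cong) (auto simp: error_op_entry[OF card_field])
    then show ?thesis by (simp add: matrix_matrix_mult_def)
  qed
  have "(?P ** error_op c a b ** ?P) $ y $ x =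
      (\<Sum>v\<in>UNIV. ?P $ y $ (v + a) * zeta TYPE('a) ^ c * vec_char b v * ?P $ v $ x)"
    by (subst matrix_matrix_mult_def) (simp add: PE)
  \<comment> \<open>Substituting \<open>v = x + w\<close> puts the support of the last factor at
    \<open>w\<close> in \<open>C\<close>.\<close>
  also have "\<dots> = (\<Sum>w\<in>UNIV. ?P $ y $ (x + w + a) * zeta TYPE('a) ^ c * vec_char b (x + w) * ?P $ (x + w) $ x)"
    by (rule sum.reindex_bij_witness[of _ "\<lambda>w. x + w" "\<lambda>v. v - x"]) auto
  also have "\<dots> = (\<Sum>w\<in>UNIV. if w \<in> C then (if x \<in> euclidean_dual C then
      ?P $ y $ (x + a) * zeta TYPE('a) ^ c * vec_char b x / of_nat (card C) else 0) * vec_char b w else 0)"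
  proof (intro sum.cong refl)
    fix w
    show "?P $ y $ (x + w + a) * zeta TYPE('a) ^ c * vec_char b (x + w) * ?P $ (x + w) $ x =
      (if w \<in> C then (if x \<in> euclidean_dual C then
      ?P $ y $ (x + a) * zeta TYPE('a) ^ c * vec_char b x / of_nat (card C) else 0) * vec_char b w else 0)"
    proof (cases "w \<in> C")
      case True
      have 1: "x + w + a \<in> euclidean_dual C \<longleftrightarrow> x + a \<in> euclidean_dual C"
        using dual_add_iff[OF True, of "x + a"] by (simp add: add_ac)
      have 2: "y - (x + w + a) \<in> C \<longleftrightarrow> y - (x + a) \<in> C"
        using add_iff[OF closed(4)[OF True], of "y - (x + a)"] by (simp add: algebra_simps)
      have "?P $ y $ (x + w + a) = ?P $ y $ (x + a)"
        unfolding css_projector_def by (simp only: vec_lambda_beta 1 2)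
      moreover have "?P $ (x + w) $ x = (if x \<in> euclidean_dual C then 1 / of_nat (card C) else 0)"
        using True by (simp add: css_projector_def)
      ultimately show ?thesis using True
        by (simp add: vec_char_add_right[OF card_field])
    qed (simp add: css_projector_def)
  qed
  also have "\<dots> = (if x \<in> euclidean_dual C then
      ?P $ y $ (x + a) * zeta TYPE('a) ^ c * vec_char b x / of_nat (card C) else 0) * (\<Sum>w\<in>C. vec_char b w)"
    by (simp add: sum.If_cases sum_distrib_left)
  finally show ?thesis
    using nonempty by (simp add: sum_vec_char_subspace[OF card_field subspace])
qed

lemma css_projector_sym: "css_projector C $ x $ y = css_projector C $ y $ x"
proof -
  have "x \<in> euclidean_dual C \<and> y - x \<in> C \<longleftrightarrow> y \<in> euclidean_dual C \<and> x - y \<in> C"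
    using closed(4)[of "y - x"] closed(4)[of "x - y"]
      dual_add_iff[of "y - x" x] dual_add_iff[of "x - y" y] by auto
  then show ?thesis by (simp add: css_projector_def)
qed

lemma css_projector_mult_vec:
  "(css_projector C *v \<psi>) $ y =
    (if y \<in> euclidean_dual C then (\<Sum>w\<in>C. \<psi> $ (y + w)) / of_nat (card C) else 0)"
proof -
  have "(css_projector C *v \<psi>) $ y = (\<Sum>x\<in>UNIV. css_projector C $ x $ y * \<psi> $ x)"
    unfolding matrix_vector_mult_def by (simp add: css_projector_sym[of y])
  also have "\<dots> = (\<Sum>w\<in>UNIV. css_projector C $ (y + w) $ y * \<psi> $ (y + w))"
    by (rule sum.reindex_bij_witness[of _ "\<lambda>w. y + w" "\<lambda>v. v - y"]) auto
  also have "\<dots> = (\<Sum>w\<in>UNIV. if w \<in> C then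
      (if y \<in> euclidean_dual C then \<psi> $ (y + w) / of_nat (card C) else 0) else 0)"
    by (intro sum.cong) (auto simp: css_projector_def)
  finally show ?thesis by (simp add: sum.If_cases sum_divide_distrib)
qed

lemma css_projector_fixes:
  assumes "\<psi> \<in> css_code C"
  shows "css_projector C *v \<psi> = \<psi>"
proof -
  have "(css_projector C *v \<psi>) $ y = \<psi> $ y" for y
  proof -
    have "(\<Sum>w\<in>C. \<psi> $ (y + w)) = (\<Sum>w\<in>C. \<psi> $ y)"
      using assms by (intro sum.cong) (auto simp: css_code_def)
    moreover have "\<psi> $ y = 0" if "y \<notin> euclidean_dual C"
      using assms that unfolding css_code_def by blast
    ultimately show ?thesis using nonempty by (simp add: css_projector_mult_vec)
  qed
  then show ?thesis by (simp add: vec_eq_iff)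
qed

lemma css_projector_range: "css_projector C *v \<psi> \<in> css_code C"
proof -
  have "(\<Sum>u\<in>C. \<psi> $ (x + w + u)) = (\<Sum>u\<in>C. \<psi> $ (x + u))" if "w \<in> C" for x w
    by (rule sum.reindex_bij_witness[of _ "\<lambda>u. u - w" "\<lambda>u. w + u"])
      (use that closed in \<open>auto simp: add_ac\<close>)
  then show ?thesis
    by (auto simp: css_code_def css_projector_mult_vec dual_add_iff split: if_splits)
qed

lemma is_orth_projector_css: "is_orth_projector (css_projector C) (css_code C)"
proof -
  \<comment> \<open>The identity is inserted as the trivial error, so that idempotence is a case of
    \<open>css_projector_error_op\<close>.\<close>
  have "css_projector C ** css_projector C = css_projector C ** error_op 0 0 0 ** css_projector C"
    by (simp add: error_op_0)
  also have "\<dots> = css_projector C"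
    using dual_closed(1)
    by (auto simp: vec_eq_iff css_projector_error_op vec_char_zero_left[OF card_field])
      (simp add: css_projector_def)
  finally have "css_projector C ** css_projector C = css_projector C" .
  moreover have "css_projector C $ x $ y = cnj (css_projector C $ y $ x)" for x y
    unfolding css_projector_sym[of x y] by (simp add: css_projector_def)
  moreover have "range ((*v) (css_projector C)) = css_code C"
  proof (intro equalityI subsetI)
    fix \<psi> assume "\<psi> \<in> css_code C"
    then have "\<psi> = css_projector C *v \<psi>" by (simp add: css_projector_fixes)
    then show "\<psi> \<in> range ((*v) (css_projector C))" by (rule range_eqI)
  qed (use css_projector_range in blast)
  ultimately show ?thesis unfolding is_orth_projector_def by blast
qed

section \<open>Detectable and undetectable errors\<close>

text \<open>If both parts lie in \<open>C\<close>, the error acts on the code as a scalar. Otherwise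
  one part lies outside the dual and the compressed operator is 0.\<close>

lemma detectable_css:
  assumes "a \<in> euclidean_dual C \<Longrightarrow> a \<in> C" and "b \<in> euclidean_dual C \<Longrightarrow> b \<in> C"
  shows "detectable (css_code C) (error_op c a b)"
proof -
  let ?P = "css_projector C"
  have "\<exists>e. ?P ** error_op c a b ** ?P = scale_op e ?P"
  proof (cases "a \<in> C \<and> b \<in> C")
    case True
    have "?P $ y $ (x + a) = ?P $ y $ x" for x y
    proof -
      have "y - (x + a) \<in> C \<longleftrightarrow> y - x \<in> C"
        using True add_iff[of "- a" "y - x"] closed(4)[of a] by (simp add: algebra_simps)
      then show ?thesis using True by (simp add: css_projector_def dual_add_iff)
    qed
    then have "?P ** error_op c a b ** ?P = scale_op (zeta TYPE('a) ^ c) ?P"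
      using True self_orthogonal
      by (auto simp: vec_eq_iff css_projector_error_op scale_op_def vec_char_code)
        (simp_all add: css_projector_def)
    then show ?thesis by blast
  next
    case False
    have "?P $ y $ (x + a) = 0" if "x \<in> euclidean_dual C" "b \<in> euclidean_dual C" for x y
    proof -
      have "a \<notin> euclidean_dual C" using False assms that(2) by blast
      then have "x + a \<notin> euclidean_dual C"
        using that(1) dual_closed(3)[of "x + a" x] by auto
      then show ?thesis by (simp add: css_projector_def)
    qed
    then have "?P ** error_op c a b ** ?P = scale_op 0 ?P"
      by (simp add: vec_eq_iff css_projector_error_op scale_op_def)
    then show ?thesis by blast
  qed
  then show ?thesis using is_orth_projector_css by (auto simp: detectable_def)
qed

text \<open>The code state of the trivial coset. It shows that the code is nonzero and serves as the
  test vector for undetectable errors.\<close>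

definition uniform_state :: "('a ^ 'n) cvec" where
  "uniform_state = (\<chi> y. if y \<in> C then 1 else 0)"

lemma uniform_state_in_css_code: "uniform_state \<in> css_code C"
  using self_orthogonal by (auto simp: uniform_state_def css_code_def add_iff)

text \<open>\<open>X(a)\<close> sends \<open>uniform_state\<close> to the state of the coset
  \<open>a + C\<close>, which is again in the code but is supported away from \<open>C\<close>, so
  it is no scalar multiple of \<open>uniform_state\<close>.\<close>

lemma not_detectable_css:
  assumes "a \<in> euclidean_dual C" and "a \<notin> C"
  shows "\<not> detectable (css_code C) (error_op 0 a 0)"
proof
  assume "detectable (css_code C) (error_op 0 a 0)"
  then obtain P e where P: "is_orth_projector P (css_code C)"
    and e: "P ** error_op 0 a 0 ** P = scale_op e P"
    by (auto simp: detectable_def)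
  \<comment> \<open>\<open>detectable\<close> allows any orthogonal projector onto the code; all
    that matters is that an idempotent fixes its range.\<close>
  have P_fix: "P *v \<psi> = \<psi>" if "\<psi> \<in> css_code C" for \<psi>
  proof -
    have "\<psi> \<in> range ((*v) P)" using that P by (simp only: is_orth_projector_def)
    then obtain \<phi> where "\<psi> = P *v \<phi>" by blast
    then show ?thesis using P by (simp add: is_orth_projector_def matrix_vector_mul_assoc)
  qed
  let ?s = "error_op 0 a 0 *v uniform_state"
  have s: "?s $ y = (if y - a \<in> C then 1 else 0)" for y
    by (simp add: error_op_mult_vec[OF card_field] vec_char_zero_left[OF card_field] uniform_state_def)
  have "x \<in> euclidean_dual C" if "x - a \<in> C" for x
    using dual_closed(2)[of "x - a" a] that assms(1) self_orthogonal by auto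
  moreover have "x + w - a \<in> C \<longleftrightarrow> x - a \<in> C" if "w \<in> C" for x w
    using add_iff[OF that, of "x - a"] by (simp add: algebra_simps)
  ultimately have s_code: "?s \<in> css_code C"
    by (auto simp: css_code_def s)
  have "(P ** error_op 0 a 0 ** P) *v uniform_state = ?s"
    by (simp add: P_fix uniform_state_in_css_code s_code flip: matrix_vector_mul_assoc)
  moreover have "(scale_op e P *v uniform_state) $ y = e * (P *v uniform_state) $ y" for y
    by (simp add: scale_op_def matrix_vector_mult_def sum_distrib_left mult_ac)
  \<comment> \<open>At the coordinate \<open>a\<close> the shifted state is 1 while
    \<open>uniform_state\<close> is 0.\<close>
  ultimately have "?s $ a = e * uniform_state $ a"
    by (metis e P_fix uniform_state_in_css_code)
  moreover have "?s $ a = 1" using s[of a] closed(1) by simp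
  moreover have "uniform_state $ a = 0" using assms(2) by (simp add: uniform_state_def)
  ultimately show False by simp
qed

section \<open>Dimension and parameters of the code\<close>

text \<open>The indicator functions of the cosets of \<open>C\<close> in its dual form a basis. The
  product form avoids dividing natural numbers.\<close>

lemma dim_css_code: "card C * vec.dim (css_code C) = card (euclidean_dual C)"
proof -
  define coset where "coset x = (+) x ` C" for x
  define K where "K = coset ` euclidean_dual C"
  define ind :: "('a ^ 'n) set \<Rightarrow> ('a ^ 'n) cvec" where "ind A = (\<chi> y. if y \<in> A then 1 else 0)" for A
  have mem: "y \<in> coset x \<longleftrightarrow> y - x \<in> C" for x y
    by (force simp: coset_def image_iff)
  have coset_eq: "coset x = coset y" if "y \<in> coset x" for x y
  proof -
    have d: "y - x \<in> C" using that mem by simp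
    have "z - x \<in> C \<longleftrightarrow> z - y \<in> C" for z
      using add_iff[OF d, of "z - y"] by simp
    then show ?thesis by (auto simp: mem)
  qed
  have self: "x \<in> coset x" for x by (simp add: mem closed(1))
  have K_mem: "y \<in> A \<longleftrightarrow> A = coset y" if "A \<in> K" for A y
    using that coset_eq self by (auto simp: K_def)
  have K_dual: "y \<in> euclidean_dual C" if A: "A \<in> K" "y \<in> A" for A y
  proof -
    obtain x where "x \<in> euclidean_dual C" "A = coset x" using A(1) unfolding K_def by blast
    moreover have "y - x \<in> C" using calculation(2) A(2) mem by simp
    ultimately show ?thesis using dual_add_iff[of "y - x" x] by simp
  qed
  have Union_K: "\<Union>K = euclidean_dual C"
  proof (intro equalityI subsetI)
    fix y assume "y \<in> euclidean_dual C"
    then have "coset y \<in> K" by (simp add: K_def)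
    then show "y \<in> \<Union>K" using self by blast
  qed (use K_dual in blast)
  have card_K: "card C * card K = card (euclidean_dual C)"
    unfolding Union_K[symmetric]
  proof (rule card_partition)
    show "card A = card C" if "A \<in> K" for A
      using that by (auto simp: K_def coset_def card_image)
    show "A \<inter> B = {}" if "A \<in> K" "B \<in> K" "A \<noteq> B" for A B
      using K_mem that by blast
  qed auto
  have inj: "inj_on ind K"
  proof (rule inj_onI)
    fix A B assume "ind A = ind B"
    then have "(if y \<in> A then 1 else 0) = (if y \<in> B then 1 else (0::complex))" for y
      by (simp add: ind_def vec_eq_iff)
    then show "A = B" by (metis subsetI subset_antisym zero_neq_one)
  qed
  \<comment> \<open>The cosets are disjoint, so at \<open>y\<close> only the coset of
    \<open>y\<close> contributes. This yields both spanning and independence.\<close>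
  have lin: "(\<Sum>A\<in>K. f A *s ind A) $ y = (if coset y \<in> K then f (coset y) else 0)" for f y
  proof -
    have "(\<Sum>A\<in>K. f A *s ind A) $ y = (\<Sum>A\<in>K. if A = coset y then f A else 0)"
      unfolding sum_component by (intro sum.cong) (auto simp: ind_def K_mem)
    then show ?thesis by simp
  qed
  have "vec.dim (css_code C) = card (ind ` K)"
  proof (rule vec.dim_unique[of "ind ` K"])
    show "ind ` K \<subseteq> css_code C"
    proof clarify
      fix A assume A: "A \<in> K"
      have "x + w \<in> A \<longleftrightarrow> x \<in> A" if "w \<in> C" for x w
        using A add_iff[OF that, of "x - z" for z] by (auto simp: K_def mem algebra_simps)
      then show "ind A \<in> css_code C" using K_dual[OF A] by (auto simp: css_code_def ind_def)
    qed
    show "css_code C \<subseteq> vec.span (ind ` K)"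
    proof
      fix \<psi> assume \<psi>: "\<psi> \<in> css_code C"
      \<comment> \<open>Any representative will do, since \<open>\<psi>\<close> is constant on each
        coset.\<close>
      define rep where "rep A = (SOME y. y \<in> A)" for A :: "('a ^ 'n) set"
      have "\<psi> = (\<Sum>A\<in>K. \<psi> $ rep A *s ind A)"
        unfolding vec_eq_iff lin
      proof
        fix y
        have "rep (coset y) \<in> coset y" unfolding rep_def using self by (rule someI)
        then have "\<psi> $ rep (coset y) = \<psi> $ y"
          using \<psi> by (auto simp: css_code_def coset_def)
        moreover have "coset y \<in> K" if "\<psi> $ y \<noteq> 0"
          using that \<psi> by (auto simp: css_code_def K_def)
        ultimately show "\<psi> $ y = (if coset y \<in> K then \<psi> $ rep (coset y) else 0)" by auto
      qed
      also have "\<dots> \<in> vec.span (ind ` K)"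
        by (intro vec.span_sum vec.span_scale vec.span_base) auto
      finally show "\<psi> \<in> vec.span (ind ` K)" .
    qed
    show "vec.independent (ind ` K)"
    proof (rule vec.independent_if_scalars_zero)
      fix f x assume sum0: "(\<Sum>x\<in>ind ` K. f x *s x) = 0" and "x \<in> ind ` K"
      then obtain A where A: "A \<in> K" "x = ind A" by auto
      then obtain y where y: "y \<in> A" using self by (auto simp: K_def)
      have "(\<Sum>A\<in>K. f (ind A) *s ind A) = 0"
        using sum0 by (simp add: sum.reindex[OF inj] o_def)
      then have "(\<Sum>A\<in>K. f (ind A) *s ind A) $ y = 0" by simp
      then show "f x = 0" unfolding lin using A y K_mem[OF A(1)] by simp
    qed simp
  qed simp
  then show ?thesis using card_K by (simp add: card_image[OF inj])
qed

text \<open>The cardinality premise says that \<open>C\<close> has dimension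
  \<open>(n - k) / 2\<close>. With \<open>k > 0\<close> the dual is strictly larger than
  \<open>C\<close>, so the minimum weight is taken over a nonempty set.\<close>

lemma css_code_params:
  assumes "card C ^ 2 * CARD('a) ^ k = CARD('a) ^ CARD('n)" and "k > 0"
  shows "stabilizer_code_params (css_code C) CARD('n) k (min_weight (euclidean_dual C - C)) CARD('a)"
proof -
  let ?D = "euclidean_dual C"
  have Q1: "CARD('a) > 1"
    using card_mono[of UNIV "{0, 1 :: 'a}"] by simp
  have dual: "card ?D = card C * CARD('a) ^ k"
    using assms(1) card_euclidean_dual[OF card_field subspace] card_pos
    by (metis mult.assoc mult_left_cancel nat_neq_iff power2_eq_square)
  then have dim: "vec.dim (css_code C) = CARD('a) ^ k"
    using dim_css_code nonempty by simp
  have "CARD('a) ^ k > 1" using Q1 assms(2) by (rule one_less_power)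
  then have "card ?D > card C" using dual card_pos by simp
  then have ne: "?D - C \<noteq> {}" by (metis Diff_eq_empty_iff card_mono finite leD)
  have no_zero: "?D - C - {0} = ?D - C" using closed(1) by auto
  have min_le: "min_weight (?D - C) \<le> hamming_weight x" if "x \<in> ?D - C" for x
    unfolding min_weight_def no_zero using that by (intro Min_le) auto
  have "min_weight (?D - C) \<in> hamming_weight ` (?D - C)"
    unfolding min_weight_def no_zero using ne by (intro Min_in) auto
  then obtain x where x: "x \<in> ?D" "x \<notin> C" "hamming_weight x = min_weight (?D - C)" by auto
  have "detectable (css_code C) (error_op c a b)"
    if "error_weight a b < min_weight (?D - C)" for c a b
  proof (rule detectable_css)
    \<comment> \<open>Neither part of an error weighs more than the error, so the \<open>X\<close>
      and \<open>Z\<close> parts can be treated separately.\<close>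
    have "hamming_weight a \<le> error_weight a b" "hamming_weight b \<le> error_weight a b"
      unfolding hamming_weight_def error_weight_def by (auto intro!: card_mono)
    then show "a \<in> ?D \<Longrightarrow> a \<in> C" "b \<in> ?D \<Longrightarrow> b \<in> C"
      using min_le[of a] min_le[of b] that by auto
  qed
  moreover have "d \<le> min_weight (?D - C)" if "detects_below (css_code C) d" for d
  proof (rule ccontr)
    assume "\<not> ?thesis"
    \<comment> \<open>A word \<open>x\<close> of minimum weight in the dual outside \<open>C\<close>
      gives the undetectable error \<open>X(x)\<close> of the same weight.\<close>
    then have "error_weight x 0 < d" using x(3) by (simp add: error_weight_def hamming_weight_def)
    then show False using that not_detectable_css[OF x(1,2)] by (auto simp: detects_below_def)
  qed
  ultimately have "has_min_distance (css_code C) (min_weight (?D - C))"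
    by (auto simp: has_min_distance_def detects_below_def)
  moreover have "is_stabilizer_code (css_code C)"
  proof -
    have "uniform_state $ 0 = 1" by (simp add: uniform_state_def closed(1))
    then have "uniform_state \<noteq> 0" by auto
    then show ?thesis
      using abelian_error_subgroup_css css_code_eq_fixed uniform_state_in_css_code
      unfolding is_stabilizer_code_def by blast
  qed
  ultimately show ?thesis by (simp add: stabilizer_code_params_def dim)
qed

end

subsection \<open>Residue sums\<close>

lemma poly_eq_prod_distinct_roots:
  fixes g :: "'a::field poly" and \<alpha> :: "'i::finite \<Rightarrow> 'a"
  assumes "inj \<alpha>" and "degree g = CARD('i)" and "lead_coeff g = 1" and "\<And>i. poly g (\<alpha> i) = 0"
  shows "g = (\<Prod>i\<in>UNIV. [:- \<alpha> i, 1:])"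
proof (rule poly_eqI_degree_lead_coeff[where A = "range \<alpha>" and n = "CARD('i)"])
  have deg: "degree (\<Prod>i\<in>UNIV. [:- \<alpha> i, 1:]) = CARD('i)"
    by (subst degree_prod_eq_sum_degree) auto
  have "lead_coeff (\<Prod>i\<in>UNIV. [:- \<alpha> i, 1:]) = 1"
    by (simp add: lead_coeff_prod)
  then show "coeff g CARD('i) = coeff (\<Prod>i\<in>UNIV. [:- \<alpha> i, 1:]) CARD('i)"
    using assms(2,3) deg by simp
  show "degree (\<Prod>i\<in>UNIV. [:- \<alpha> i, 1:]) \<le> CARD('i)" using deg by simp
  show "CARD('i) \<le> card (range \<alpha>)" using assms(1) by (simp add: card_image)
  show "poly g z = poly (\<Prod>i\<in>UNIV. [:- \<alpha> i, 1:]) z" if "z \<in> range \<alpha>" for z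
    using that assms(4) by (auto simp: poly_prod)
qed (use assms(2) in auto)

lemma poly_pderiv_prod_linear:
  fixes \<alpha> :: "'i::finite \<Rightarrow> 'a::field"
  shows "poly (pderiv (\<Prod>i\<in>UNIV. [:- \<alpha> i, 1:])) (\<alpha> j) = (\<Prod>i\<in>UNIV - {j}. \<alpha> j - \<alpha> i)"
proof -
  have "poly (pderiv (\<Prod>i\<in>UNIV. [:- \<alpha> i, 1:])) (\<alpha> j) =
      (\<Sum>k\<in>UNIV. \<Prod>i\<in>UNIV - {k}. \<alpha> j - \<alpha> i)"
    by (simp add: pderiv_prod poly_sum poly_prod pderiv_pCons)
  also have "\<dots> = (\<Sum>k\<in>UNIV. if k = j then (\<Prod>i\<in>UNIV - {j}. \<alpha> j - \<alpha> i) else 0)"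
  proof (intro sum.cong refl)
    fix k
    have "(\<Prod>i\<in>UNIV - {k}. \<alpha> j - \<alpha> i) = 0" if "k \<noteq> j"
      using that by (intro prod_zero) auto
    then show "(\<Prod>i\<in>UNIV - {k}. \<alpha> j - \<alpha> i) =
      (if k = j then (\<Prod>i\<in>UNIV - {j}. \<alpha> j - \<alpha> i) else 0)" by simp
  qed
  finally show ?thesis by simp
qed

locale distinct_roots =
  fixes g :: "'a::field poly" and \<alpha> :: "'i::finite \<Rightarrow> 'a"
  assumes inj: "inj \<alpha>" and deg: "degree g = CARD('i)" and monic: "lead_coeff g = 1"
    and root: "\<And>i. poly g (\<alpha> i) = 0"
begin

lemma pderiv_root: "poly (pderiv g) (\<alpha> j) = (\<Prod>i\<in>UNIV - {j}. \<alpha> j - \<alpha> i)"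
  using poly_pderiv_prod_linear[of \<alpha> j] poly_eq_prod_distinct_roots[OF inj deg monic root] by simp

lemma pderiv_root_nonzero: "poly (pderiv g) (\<alpha> j) \<noteq> 0"
  unfolding pderiv_root using inj by (auto simp: inj_eq)

text \<open>The sum of the residues of \<open>f / g\<close>, whose poles are at most simple. With
  \<open>v_i^2 = 1 / g'(\<alpha>_i)\<close> it becomes the Euclidean product of evaluation
  vectors.\<close>

definition residue_sum :: "'a poly \<Rightarrow> 'a" where
  "residue_sum f = (\<Sum>i\<in>UNIV. poly f (\<alpha> i) / poly (pderiv g) (\<alpha> i))"

lemma residue_sum_add: "residue_sum (f + h) = residue_sum f + residue_sum h"
  by (simp add: residue_sum_def add_divide_distrib sum.distrib)

lemma residue_sum_smult: "residue_sum (smult e f) = e * residue_sum f"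
  by (simp add: residue_sum_def sum_distrib_left)

text \<open>The functional depends only on \<open>f\<close> modulo \<open>g\<close>, which gives its
  values on monomials of degree \<open>n\<close> and above.\<close>

lemma residue_sum_root_mult: "residue_sum (g * f) = 0"
  by (simp add: residue_sum_def root)

text \<open>Compare the coefficients of \<open>x\<^sup>n\<^sup>-\<^sup>1\<close> in Lagrange's interpolation formula.\<close>

lemma residue_sum_degree_less:
  assumes "degree f < CARD('i)"
  shows "residue_sum f = coeff f (CARD('i) - 1)"
proof -
  let ?n = "CARD('i)"
  \<comment> \<open>Unnormalised Lagrange basis polynomials: \<open>B j\<close> takes the value
    \<open>g'(\<alpha> j)\<close> at \<open>\<alpha> j\<close>.\<close>
  define B where "B j = (\<Prod>i\<in>UNIV - {j}. [:- \<alpha> i, 1:])" for j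
  define e where "e j = poly f (\<alpha> j) / poly (pderiv g) (\<alpha> j)" for j
  define h where "h = (\<Sum>j\<in>UNIV. smult (e j) (B j))"
  have deg_B: "degree (B j) = ?n - 1" for j
    unfolding B_def by (subst degree_prod_eq_sum_degree) (auto simp: card_Diff_singleton)
  have lead_B: "coeff (B j) (?n - 1) = 1" for j
    using lead_coeff_prod[of "\<lambda>i. [:- \<alpha> i, 1:]" "UNIV - {j}"] deg_B[of j] by (simp add: B_def)
  have poly_B: "poly (B j) (\<alpha> k) = (if j = k then poly (pderiv g) (\<alpha> k) else 0)" for j k
  proof (cases "j = k")
    case False
    then have "(\<Prod>i\<in>UNIV - {j}. poly [:- \<alpha> i, 1:] (\<alpha> k)) = 0"
      by (intro prod_zero) auto
    then show ?thesis using False by (simp add: B_def poly_prod)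
  qed (simp add: B_def poly_prod pderiv_root)
  have "f = h"
  proof (rule poly_eqI_degree[where A = "range \<alpha>"])
    have "degree h \<le> ?n - 1" unfolding h_def
      by (intro degree_sum_le) (auto intro: order.trans[OF degree_smult_le] simp: deg_B)
    then show "card (range \<alpha>) > degree h" using inj by (simp add: card_image)
        (metis One_nat_def Suc_pred le_imp_less_Suc zero_less_card_finite)
    show "card (range \<alpha>) > degree f" using inj assms by (simp add: card_image)
    fix z assume "z \<in> range \<alpha>"
    then obtain k where k: "z = \<alpha> k" by auto
    have "poly h z = (\<Sum>j\<in>UNIV. if j = k then e k * poly (pderiv g) (\<alpha> k) else 0)"
      unfolding h_def poly_sum k by (intro sum.cong) (auto simp: poly_B)
    then show "poly f z = poly h z"
      using pderiv_root_nonzero[of k] by (simp add: k e_def)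
  qed
  then have "coeff f (?n - 1) = (\<Sum>j\<in>UNIV. e j)"
    by (simp add: h_def coeff_sum lead_B[simplified])
  then show ?thesis by (simp add: residue_sum_def e_def)
qed

end

subsection \<open>The code\<close>

definition S1_poly :: "nat \<Rightarrow> 'a::field \<Rightarrow> 'a \<Rightarrow> (nat \<Rightarrow> 'a) \<Rightarrow> 'a poly" where
  "S1_poly m a b f =
    (\<Sum>i<m. monom (f i) i) + smult (2 / b * f (m - 1)) (monom a m + monom 1 (m + 1))"

lemma S1_eq_range: "S1 n a b = range (S1_poly ((n - 1) div 2) a b)"
  by (auto simp: S1_def S1_poly_def Let_def)

lemma S1_poly_add: "S1_poly m a b f + S1_poly m a b h = S1_poly m a b (\<lambda>i. f i + h i)"
  by (simp add: S1_poly_def sum.distrib distrib_left smult_add_left smult_add_right flip: add_monom)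

lemma S1_poly_smult: "smult e (S1_poly m a b f) = S1_poly m a b (\<lambda>i. e * f i)"
proof -
  have "smult e (\<Sum>i<m. monom (f i) i) = (\<Sum>i<m. monom (e * f i) i)"
    by (induction m) (simp_all add: smult_add_right smult_monom)
  then show ?thesis by (simp add: S1_poly_def smult_add_right mult_ac)
qed

lemma coeff_S1_poly: "i < m \<Longrightarrow> coeff (S1_poly m a b f) i = f i"
  by (simp add: S1_poly_def coeff_sum)

lemma degree_S1_poly: "degree (S1_poly m a b f) \<le> m + 1"
  unfolding S1_poly_def
  by (intro degree_add_le degree_sum_le order.trans[OF degree_smult_le])
    (auto intro: order.trans[OF degree_monom_le])

text \<open>The coefficients below \<open>m\<close> recover the parameters. Since
  \<open>m > 0\<close>, the index \<open>m - 1\<close> of the top part is among them.\<close>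

lemma card_range_S1_poly:
  assumes "m > 0"
  shows "card (range (S1_poly m (a :: 'a::{field,finite}) b)) = CARD('a) ^ m"
proof -
  let ?F = "{..<m} \<rightarrow>\<^sub>E (UNIV :: 'a set)"
  have "S1_poly m a b f = S1_poly m a b (restrict f {..<m})" for f
    using assms by (simp add: S1_poly_def)
  then have "range (S1_poly m a b) = S1_poly m a b ` ?F"
    by (auto simp: image_iff) (metis UNIV_I restrict_PiE_iff)
  moreover have "inj_on (S1_poly m a b) ?F"
  proof (rule inj_onI)
    fix f h assume *: "f \<in> ?F" "h \<in> ?F" "S1_poly m a b f = S1_poly m a b h"
    have "f i = h i" if "i < m" for i
      using coeff_S1_poly[OF that] *(3) by metis
    then show "f = h" using PiE_ext[OF *(1,2)] by auto
  qed
  ultimately show ?thesis by (simp add: card_image card_PiE)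
qed

lemma ev_add: "ev \<alpha> v (f + h) = ev \<alpha> v f + ev \<alpha> v h"
  by (simp add: ev_def vec_eq_iff distrib_left)

lemma ev_smult: "ev \<alpha> v (smult e f) = e *s ev \<alpha> v f"
  by (simp add: ev_def vec_eq_iff mult_ac)

lemma subspace_ev_S1: "vec.subspace (ev \<alpha> v ` S1 n a b)"
proof -
  have "S1_poly m a b (\<lambda>_. 0) = 0" for m and a b :: 'a by (simp add: S1_poly_def)
  then have "0 \<in> S1 n a b" unfolding S1_eq_range by (metis rangeI)
  moreover have "ev \<alpha> v 0 = 0" by (simp add: ev_def vec_eq_iff)
  ultimately have "0 \<in> ev \<alpha> v ` S1 n a b" by (metis imageI)
  then show ?thesis
    by (auto simp: vec.subspace_def S1_eq_range simp flip: ev_add ev_smult S1_poly_add)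
      (auto simp: S1_poly_add S1_poly_smult)
qed

text \<open>Polynomials of degree below \<open>n\<close> that agree at \<open>n\<close> distinct
  points are equal.\<close>

lemma inj_on_ev:
  fixes \<alpha> v :: "'a::field ^ 'n"
  assumes "inj (\<lambda>i. \<alpha> $ i)" and "\<And>i. v $ i \<noteq> 0"
  shows "inj_on (ev \<alpha> v) {f. degree f < CARD('n)}"
proof (rule inj_onI)
  fix f h assume *: "f \<in> {f. degree f < CARD('n)}" "h \<in> {f. degree f < CARD('n)}" "ev \<alpha> v f = ev \<alpha> v h"
  have "poly f (\<alpha> $ i) = poly h (\<alpha> $ i)" for i
    using *(3) assms(2)[of i] by (auto simp: ev_def vec_eq_iff)
  then show "f = h"
    using * assms(1) by (intro poly_eqI_degree[where A = "range (\<lambda>i. \<alpha> $ i)"]) (auto simp: card_image)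
qed

text \<open>The polynomial in \<open>S1\<close> multiplying the coefficient \<open>f\<^sub>k\<close>, where \<open>k = (n - 1) / 2 - 1\<close>.\<close>

definition top_part :: "nat \<Rightarrow> 'a::field \<Rightarrow> 'a \<Rightarrow> 'a poly" where
  "top_part k a b = monom 1 k + (monom (2 / b * a) (k + 1) + monom (2 / b) (k + 2))"

text \<open>Factoring out \<open>monom 1 k\<close> leaves the square of a quadratic polynomial; the
  sum of monomials lets \<open>residue_sum\<close> be evaluated term by term.\<close>

lemma top_part_square:
  "top_part k a b * top_part k a b = monom 1 (2 * k) + (monom (2 * (2 / b) * a) (2 * k + 1)
      + (monom (2 * (2 / b) + (2 / b)\<^sup>2 * a\<^sup>2) (2 * k + 2)
      + (monom (2 * (2 / b)\<^sup>2 * a) (2 * k + 3) + monom ((2 / b)\<^sup>2) (2 * k + 4))))"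
proof -
  have "monom 1 k + (monom (e * a) (k + 1) + monom e (k + 2)) = monom 1 k * [:1, e * a, e:]" for e
    by (rule poly_eqI) (simp add: coeff_monom_mult coeff_pCons split: nat.split)
  moreover have "monom x0 j + (monom x1 (j + 1) + (monom x2 (j + 2) + (monom x3 (j + 3) + monom x4 (j + 4))))
     = monom 1 j * [:x0, x1, x2, x3, x4:]" for j and x0 x1 x2 x3 x4 :: 'a
    by (simp add: distrib_left smult_monom monom_Suc eval_nat_numeral)
  moreover have "[:1, e * a, e:] * [:1, e * a, e:] =
      [:1, 2 * e * a, 2 * e + e\<^sup>2 * a\<^sup>2, 2 * e\<^sup>2 * a, e\<^sup>2:]" for e
    by (simp add: power2_eq_square algebra_simps)
  moreover have "(monom 1 k * q) * (monom 1 k * q) = monom 1 (2 * k) * (q * q)" for q :: "'a poly"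
    using mult_monom[of 1 k "1::'a" k] by (simp add: mult_2)
  ultimately show ?thesis unfolding top_part_def by metis
qed

lemma degree_top_part: "degree (top_part k a b) \<le> k + 2"
  unfolding top_part_def
  by (intro degree_add_le) (auto intro: order.trans[OF degree_monom_le])

section \<open>The residue functional of the quadrinomial \<open>g\<close>\<close>

locale quadrinomial_roots = distinct_roots g \<alpha>
  for g :: "'a::field poly" and \<alpha> :: "'i::finite \<Rightarrow> 'a" +
  fixes n m :: nat and a b c :: 'a
  assumes n: "CARD('i) = n" "n = 2 * m + 1" "m > 0"
    and b: "b \<noteq> 0"
    and g: "g = monom 1 n + monom a (n - 1) + monom b (n - 2) + monom c 0"
begin

lemma residue_sum_monom_less: "k < n - 1 \<Longrightarrow> residue_sum (monom e k) = 0"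
  using residue_sum_degree_less[of "monom e k"] n
  by (simp add: degree_monom_eq le_less_trans[OF degree_monom_le])

lemma residue_sum_monom_m: "residue_sum (monom e (2 * m)) = e"
  using residue_sum_degree_less[of "monom e (2 * m)"] n
  by (simp add: le_less_trans[OF degree_monom_le])

text \<open>Reduction by \<open>smult e g\<close>: besides the leading term only the term in
  \<open>x^(n-1)\<close> contributes.\<close>

lemma residue_sum_monom_n: "residue_sum (monom e (2 * m + 1)) = - a * e"
proof -
  have "smult e g = monom e (2 * m + 1) + (monom (e * a) (2 * m) + (monom (e * b) (2 * m - 1) + monom (e * c) 0))"
    by (simp add: g n(2) smult_add_right smult_monom)
  then have "residue_sum (smult e g) = residue_sum (monom e (2 * m + 1)) + e * a"
    using n by (simp add: residue_sum_add residue_sum_monom_m residue_sum_monom_less)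
  then show ?thesis
    using residue_sum_root_mult[of "[:e:]"] by (simp add: eq_neg_iff_add_eq_0 mult.commute)
qed

text \<open>Reduction by \<open>x * g\<close>. Its last term has degree 1, below
  \<open>n - 1\<close> because \<open>m > 0\<close>, and contributes nothing.\<close>

lemma residue_sum_monom_Suc_n: "residue_sum (monom e (2 * m + 2)) = (a\<^sup>2 - b) * e"
proof -
  have "g * monom e 1 = monom e (2 * m + 2) + (monom (e * a) (2 * m + 1) + (monom (e * b) (2 * m) + monom (e * c) 1))"
  proof -
    \<comment> \<open>Writing \<open>m\<close> as a successor removes the truncated subtraction from
      the exponents.\<close>
    obtain k where "m = Suc k" using n(3) by (cases m) auto
    then show ?thesis by (simp add: g n(2) distrib_right mult_monom mult.commute[of e])
  qed
  then have "0 = residue_sum (monom e (2 * m + 2)) + (- a * (e * a) + e * b)"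
    using n residue_sum_root_mult[of "monom e 1"]
    by (simp add: residue_sum_add residue_sum_monom_m residue_sum_monom_n[simplified] residue_sum_monom_less)
  then show ?thesis by (simp add: algebra_simps power2_eq_square)
qed

text \<open>The last parameter governs all coefficients from \<open>x^(m-1)\<close> upwards.
  Vanishing coefficients, rather than a strict degree bound, also cover \<open>m = 1\<close>, where
  \<open>l\<close> is 0.\<close>

lemma S1_decompose:
  assumes "f \<in> S1 n a b"
  obtains l u where "f = l + smult u (top_part (m - 1) a b)" and "\<forall>k\<ge>m - 1. coeff l k = 0"
proof -
  have m: "(n - 1) div 2 = m" using n by simp
  obtain F where F: "f = (\<Sum>i<m. monom (F i) i) + smult (2 / b * F (m - 1)) (monom a m + monom 1 (m + 1))"
    using assms unfolding S1_eq_range S1_poly_def m by blast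
  obtain k where k: "m = Suc k" using n(3) by (cases m) auto
  have "f = (\<Sum>i<k. monom (F i) i) + smult (F k) (top_part k a b)"
    unfolding F top_part_def k by (simp add: smult_add_right smult_monom mult.commute)
  moreover have "coeff (\<Sum>i<k. monom (F i) i) j = 0" if "j \<ge> k" for j
    using that by (auto simp: coeff_sum intro!: sum.neutral)
  ultimately show ?thesis using that[of "\<Sum>i<k. monom (F i) i" "F k"] k by simp
qed

text \<open>The degree is at most \<open>(m - 2) + (m + 1) = 2 * m - 1\<close>, so the coefficient
  of \<open>x^(n-1)\<close> is 0.\<close>

lemma residue_sum_low_mult:
  assumes "\<forall>k\<ge>m - 1. coeff l k = 0" and "degree h \<le> m + 1"
  shows "residue_sum (l * h) = 0"
proof (cases "l = 0")
  case False
  then have "degree l < m - 1" using assms(1) by (metis leading_coeff_0_iff not_le)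
  then have "degree (l * h) < n - 1"
    using degree_mult_le[of l h] assms(2) n by linarith
  then show ?thesis using residue_sum_degree_less[of "l * h"] n by (simp add: coeff_eq_0)
qed (simp add: residue_sum_def)

text \<open>The coefficients of \<open>top_part\<close> are chosen to make this sum vanish.\<close>

lemma residue_sum_top_square: "residue_sum (top_part (m - 1) a b * top_part (m - 1) a b) = 0"
proof -
  have k: "2 * (m - 1) + 2 = 2 * m" "2 * (m - 1) + 3 = 2 * m + 1" "2 * (m - 1) + 4 = 2 * m + 2"
    using n by auto
  have "residue_sum (top_part (m - 1) a b * top_part (m - 1) a b) =
      (2 * (2 / b) + (2 / b)\<^sup>2 * a\<^sup>2) + (- a * (2 * (2 / b)\<^sup>2 * a) + (a\<^sup>2 - b) * (2 / b)\<^sup>2)"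
    unfolding top_part_square k residue_sum_add residue_sum_monom_m residue_sum_monom_n
      residue_sum_monom_Suc_n using n by (simp add: residue_sum_monom_less)
  \<comment> \<open>With \<open>e = 2 / b\<close> the terms in \<open>a^2\<close> cancel and
    \<open>2 * e - b * e^2\<close> is left.\<close>
  also have "\<dots> = 0" using b by (simp add: field_simps power2_eq_square)
  finally show ?thesis .
qed

lemma residue_sum_S1_mult:
  assumes "f \<in> S1 n a b" and "h \<in> S1 n a b"
  shows "residue_sum (f * h) = 0"
proof -
  obtain l u where f: "f = l + smult u (top_part (m - 1) a b)" and l: "\<forall>k\<ge>m - 1. coeff l k = 0"
    by (rule S1_decompose[OF assms(1)])
  obtain l' u' where h: "h = l' + smult u' (top_part (m - 1) a b)" and l': "\<forall>k\<ge>m - 1. coeff l' k = 0"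
    by (rule S1_decompose[OF assms(2)])
  have deg_top: "degree (top_part (m - 1) a b) \<le> m + 1"
    using degree_top_part[of "m - 1" a b] n by simp
  have "degree l' \<le> m + 1" by (rule degree_le) (use l' in auto)
  then have "degree h \<le> m + 1" unfolding h
    by (intro degree_add_le order.trans[OF degree_smult_le] deg_top)
  \<comment> \<open>Only \<open>f\<close> is expanded in the first term, so that
    \<open>residue_sum_low_mult\<close> handles \<open>l * h\<close> as a whole; the top square
    alone needs the special coefficients.\<close>
  have "f * h = l * h + (smult u (l' * top_part (m - 1) a b) + smult (u * u') (top_part (m - 1) a b * top_part (m - 1) a b))"
    by (simp add: f h algebra_simps)
  then show ?thesis
    using residue_sum_low_mult[OF l \<open>degree h \<le> m + 1\<close>] residue_sum_low_mult[OF l' deg_top]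
    by (simp add: residue_sum_add residue_sum_smult residue_sum_top_square[simplified])
qed

end

text \<open>The field of \<open>q^2\<close> elements is the type \<open>'a\<close>, and the two
  smaller fields are subsets of it. Existence of \<open>v\<close> is a separate conjunct, so that
  the claim for all \<open>v\<close> is not vacuous.\<close>

theorem proposition32:
  fixes p s h t r q n :: nat
    and a b c :: "'a::finite_field"
    and Fpt Fq :: "'a set"
    and g :: "'a poly"
    and \<alpha> :: "'a ^ 'n"
  assumes "prime p" and "odd p"
    and "s > 0" and "h > 0" and "t > 0" and "r > 0"
    and "odd r" and "t dvd h" and "s \<le> h" and "coprime r p"
    and "q = p ^ h" and "n = r * p ^ s"
    and "CARD('a) = q ^ 2" and "CARD('n) = n"
    and "is_subfield Fpt" and "card Fpt = p ^ t"
    and "is_subfield Fq" and "card Fq = q"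
    and "a \<in> Fpt" and "b \<in> Fpt" and "c \<in> Fpt"
    and "a \<noteq> 0" and "b \<noteq> 0" and "c \<noteq> 0"
    and "g = monom 1 n + monom a (n - 1) + monom b (n - 2) + monom c 0"
    and "is_splitting_field Fpt Fq g"
    and "inj (\<lambda>i. \<alpha> $ i)" and "range (\<lambda>i. \<alpha> $ i) = {x. poly g x = 0}"
  shows "(\<exists>v :: 'a ^ 'n. \<forall>i. (v $ i) ^ 2 = inverse (poly (pderiv g) (\<alpha> $ i))) \<and>
    (\<forall>v :: 'a ^ 'n. (\<forall>i. (v $ i) ^ 2 = inverse (poly (pderiv g) (\<alpha> $ i))) \<longrightarrow>
      (let C1 = ev \<alpha> v ` S1 n a b in
        \<exists>V :: (complex ^ ('a ^ 'n)) set.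
          stabilizer_code_params V n 1 (min_weight (euclidean_dual C1 - C1)) (q ^ 2)))"
proof -
  note card_a = \<open>CARD('a) = q ^ 2\<close> and card_n = \<open>CARD('n) = n\<close>
  have "CARD('a) = p ^ (2 * h)"
    by (simp add: card_a \<open>q = p ^ h\<close> mult.commute flip: power_mult)
  then have char: "CHAR('a) = p" and card_field: "CARD('a) = CHAR('a) ^ (2 * h)"
    using CHAR_eq_of_CARD_prime_power[OF \<open>prime p\<close>] by metis+
  have p3: "p \<ge> 3"
    using prime_ge_2_nat[OF \<open>prime p\<close>] \<open>odd p\<close> by (cases "p = 2") auto
  have "p ^ 1 \<le> p ^ s" using p3 \<open>s > 0\<close> by (intro power_increasing) auto
  also have "p ^ s \<le> n" using \<open>r > 0\<close> by (simp add: \<open>n = r * p ^ s\<close>)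
  finally have n3: "n \<ge> 3" using p3 by simp
  have "odd n" using \<open>odd p\<close> \<open>odd r\<close> by (simp add: \<open>n = r * p ^ s\<close>)
  define m where "m = (n - 1) div 2"
  have nm: "n = 2 * m + 1" "m > 0"
    using n3 \<open>odd n\<close> by (auto simp: m_def elim!: oddE)
  \<comment> \<open>As \<open>n \<ge> 3\<close>, no subtraction is truncated and only the first
    monomial reaches degree \<open>n\<close>.\<close>
  have "n - 1 \<noteq> n" "n - 2 \<noteq> n" using n3 by auto
  then have lead: "coeff g n = 1" using n3 by (simp add: assms(25))
  have "degree g \<le> n" unfolding assms(25)
    using n3 by (intro degree_add_le) (auto intro: order.trans[OF degree_monom_le])
  then have deg: "degree g = n" using lead by (metis le_antisym le_degree zero_neq_one)
  interpret quadrinomial_roots g "\<lambda>i. \<alpha> $ i" n m a b c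
  proof
    show "poly g (\<alpha> $ i) = 0" for i using assms(28) by blast
  qed (use assms(23,25,27) card_n nm deg lead in auto)
  \<comment> \<open>The derivative at a root is a product of differences of roots, so its inverse
    lies in \<open>Fq\<close> and is fixed by the \<open>q\<close>-th power.\<close>
  have "\<exists>x. x ^ 2 = inverse (poly (pderiv g) (\<alpha> $ i))" for i
  proof (rule square_root_of_subfield_element)
    have sub: "splits_over Fq g" using assms(26) by (simp add: is_splitting_field_def)
    have "g \<noteq> 0" using lead by auto
    have in_Fq: "\<alpha> $ j \<in> Fq" for j
      by (rule root_in_splitting_set[OF sub \<open>g \<noteq> 0\<close> root])
    have "poly (pderiv g) (\<alpha> $ i) \<in> Fq" unfolding pderiv_root
      using in_Fq assms(17) by (intro prod_in_subfield) (auto simp: is_subfield_def)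
    then have "inverse (poly (pderiv g) (\<alpha> $ i)) \<in> Fq"
      using assms(17) by (simp add: is_subfield_def)
    from power_card_subfield_eq_same[OF assms(17) this] assms(18)
    show "inverse (poly (pderiv g) (\<alpha> $ i)) ^ q = inverse (poly (pderiv g) (\<alpha> $ i))" by simp
    show "odd q" using \<open>odd p\<close> by (simp add: \<open>q = p ^ h\<close>)
  qed (rule card_a)
  then obtain w where "\<forall>i. w i ^ 2 = inverse (poly (pderiv g) (\<alpha> $ i))" by metis
  then have "\<exists>v :: 'a ^ 'n. \<forall>i. (v $ i) ^ 2 = inverse (poly (pderiv g) (\<alpha> $ i))"
    by (intro exI[of _ "\<chi> i. w i"]) simp
  moreover have "stabilizer_code_params (css_code (ev \<alpha> v ` S1 n a b)) n 1
      (min_weight (euclidean_dual (ev \<alpha> v ` S1 n a b) - ev \<alpha> v ` S1 n a b)) (q ^ 2)"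
    if v: "\<forall>i. (v $ i) ^ 2 = inverse (poly (pderiv g) (\<alpha> $ i))" for v
  proof -
    let ?C = "ev \<alpha> v ` S1 n a b"
    \<comment> \<open>The choice of \<open>v\<close> turns the Euclidean product of codewords into a
      residue sum, so self-orthogonality becomes \<open>residue_sum_S1_mult\<close>.\<close>
    have orth: "(\<Sum>i\<in>UNIV. ev \<alpha> v f $ i * ev \<alpha> v f' $ i) = residue_sum (f * f')" for f f'
    proof -
      have "ev \<alpha> v f $ i * ev \<alpha> v f' $ i = poly (f * f') (\<alpha> $ i) / poly (pderiv g) (\<alpha> $ i)" for i
      proof -
        have "ev \<alpha> v f $ i * ev \<alpha> v f' $ i = poly (f * f') (\<alpha> $ i) * (v $ i) ^ 2"
          by (simp add: ev_def power2_eq_square)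
        then show ?thesis by (simp add: v divide_inverse)
      qed
      then show ?thesis by (simp add: residue_sum_def)
    qed
    interpret C: self_orthogonal_code ?C "2 * h"
    proof
      show "?C \<subseteq> euclidean_dual ?C"
        by (auto simp: euclidean_dual_def orth residue_sum_S1_mult)
    qed (rule card_field subspace_ev_S1)+
    have v0: "v $ i \<noteq> 0" for i
      using v pderiv_root_nonzero[of i] by (metis inverse_zero_imp_zero zero_power2)
    \<comment> \<open>Here \<open>m > 0\<close> gives \<open>m + 1 < 2 * m + 1\<close>, so
      evaluation is injective on \<open>S1\<close>.\<close>
    have "degree (S1_poly m a b f) < CARD('n)" for f
      using degree_S1_poly[of m a b f] nm card_n by linarith
    then have "S1 n a b \<subseteq> {f. degree f < CARD('n)}"
      unfolding S1_eq_range m_def[symmetric] by auto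
    then have "inj_on (ev \<alpha> v) (S1 n a b)"
      using inj_on_ev[OF assms(27) v0] inj_on_subset by blast
    then have "card ?C = CARD('a) ^ m"
      using card_range_S1_poly[OF nm(2), of a b] by (simp add: card_image S1_eq_range m_def)
    \<comment> \<open>With \<open>Q = CARD('a)\<close>, the count \<open>(Q^m)^2 * Q = Q^n\<close>
      is the premise of \<open>css_code_params\<close> for \<open>k = 1\<close>.\<close>
    then have "card ?C ^ 2 * CARD('a) ^ 1 = CARD('a) ^ CARD('n)"
      by (simp add: card_n nm(1) power_add mult.commute flip: power_mult)
    from C.css_code_params[OF this] show ?thesis by (simp add: card_n card_a)
  qed
  ultimately show ?thesis unfolding Let_def by blast
qed

end
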